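(* Let $\mathcal H_1=\mathcal H_1(\Omega_1)$ and $\mathcal H_2=\mathcal H_2(\Omega_2)$ be functional Hilbert spaces, let $X\in\mathcal B(\mathcal H_2,\mathcal H_1)$ and $Y\in\mathcal B(\mathcal H_1,\mathcal H_2)$, and let $T=\begin{bmatrix}0&X\\ Y&0\end{bmatrix}\in\mathcal B(\mathcal H_1\oplus\mathcal H_2)$. Let $r\ge 1$ be real and let $f,g$ be nonnegative continuous functions on $[0,\infty)$ satisfying $f(t)g(t)=t$ for all $t\in[0,\infty)$. Then $$(\mathbf{ber}(T))^{r}\le \frac{2^r}{2}\,\mathbf{ber}^{\frac12}\big(f^{2r}(|X|)+g^{2r}(|Y^*|)\big)\,\mathbf{ber}^{\frac12}\big(f^{2r}(|Y|)+g^{2r}(|X^*|)\big)$$ and $$(\mathbf{ber}(T))^{r}\le \frac{2^r}{2}\,\mathbf{ber}^{\frac12}\big(f^{2r}(|X|)+f^{2r}(|Y^*|)\big)\,\mathbf{ber}^{\frac12}\big(g^{2r}(|Y|)+g^{2r}(|X^*|)\big).$$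
   Context: A functional Hilbert space $\mathcal H=\mathcal H(\Omega)$ is a Hilbert space of complex valued functions on a nonempty set $\Omega$ such that for each $\lambda\in\Omega$ the evaluation $h\mapsto h(\lambda)$ is a continuous linear functional on $\mathcal H$; $k_\lambda\in\mathcal H$ denotes the unique element with $h(\lambda)=\langle h,k_\lambda\rangle$ for all $h\in\mathcal H$ (the reproducing kernel, tacitly nonzero for every $\lambda$), and $\hat k_\lambda=k_\lambda/\|k_\lambda\|$. For a bounded operator $A$ on $\mathcal H$, the Berezin symbol is $\widetilde A(\lambda)=\langle A\hat k_\lambda,\hat k_\lambda\rangle$ and the Berezin number is $\mathbf{ber}(A)=\sup\{|\widetilde A(\lambda)|:\lambda\in\Omega\}$; $\mathbf{ber}^{s}(A)=(\mathbf{ber}(A))^s$. On $\mathcal H_1(\Omega_1)\oplus\mathcal H_2(\Omega_2)$ the kernels are indexed by $(\lambda_1,\lambda_2)\in\Omega_1\times\Omega_2$: $k_{(\lambda_1,\lambda_2)}=(k_{\lambda_1},k_{\lambda_2})$, with normalization $\hat k_{(\lambda_1,\lambda_2)}=(k_{\lambda_1},k_{\lambda_2})/\sqrt{\|k_{\lambda_1}\|^2+\|k_{\lambda_2}\|^2}$, and for a bounded operator $T$ on the direct sum $\mathbf{ber}(T)=\sup_{(\lambda_1,\lambda_2)}|\langle T\hat k_{(\lambda_1,\lambda_2)},\hat k_{(\lambda_1,\lambda_2)}\rangle|$. $\mathcal B(\mathcal H,\mathcal K)$ is the space of bounded linear operators from $\mathcal H$ to $\mathcal K$, $|A|=(A^*A)^{1/2}$,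 and functions of positive operators are taken by continuous functional calculus, with $f^{s}(|A|)$ meaning $(f(|A|))^{s}$. *)

theory Defs
  imports "HOL-Analysis.Analysis" "HOL-Computational_Algebra.Polynomial"
begin

section \<open>Complex Hilbert spaces\<close>

text \<open>
  The complex structure is put on top of the library's real inner product spaces, so that norm,
  topology and completeness are the library's. By \<open>inner_eq_Re_cinner\<close> and
  \<open>norm_eq_sqrt_inner\<close> the norm is the one induced by \<open>cinner\<close>, which is linear in its first and
  antilinear in its second argument.
\<close>

class complex_inner = real_inner +
  fixes scaleC :: "complex \<Rightarrow> 'a \<Rightarrow> 'a" (infixr "*\<^sub>C" 75)
    and cinner :: "'a \<Rightarrow> 'a \<Rightarrow> complex"
  assumes scaleC_add_right: "c *\<^sub>C (x + y) = c *\<^sub>C x + c *\<^sub>C y"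
    and scaleC_add_left: "(c + d) *\<^sub>C x = c *\<^sub>C x + d *\<^sub>C x"
    and scaleC_scaleC: "c *\<^sub>C d *\<^sub>C x = (c * d) *\<^sub>C x"
    and scaleC_one: "1 *\<^sub>C x = x"
    and scaleR_eq_scaleC: "a *\<^sub>R x = complex_of_real a *\<^sub>C x"
    and cinner_add_left: "cinner (x + y) z = cinner x z + cinner y z"
    and cinner_scaleC_left: "cinner (c *\<^sub>C x) y = c * cinner x y"
    and cinner_commute: "cinner x y = cnj (cinner y x)"
    and inner_eq_Re_cinner: "inner x y = Re (cinner x y)"

class complex_hilbert = complex_inner + complete_space

instantiation complex :: complex_hilbert
begin

definition scaleC_complex :: "complex \<Rightarrow> complex \<Rightarrow> complex"
  where "scaleC_complex c x = c * x"

definition cinner_complex :: "complex \<Rightarrow> complex \<Rightarrow> complex"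
  where "cinner_complex x y = x * cnj y"

instance
  by standard
    (auto simp: scaleC_complex_def cinner_complex_def algebra_simps scaleR_conv_of_real
      inner_complex_def)

end

text \<open>
  The Hilbert space direct sum: the library's norm on pairs is
  \<open>norm (x, y) = sqrt ((norm x)\<^sup>2 + (norm y)\<^sup>2)\<close>.
\<close>

instantiation prod :: (complex_inner, complex_inner) complex_inner
begin

definition scaleC_prod :: "complex \<Rightarrow> 'a \<times> 'b \<Rightarrow> 'a \<times> 'b"
  where "scaleC_prod c x = (c *\<^sub>C fst x, c *\<^sub>C snd x)"

definition cinner_prod :: "'a \<times> 'b \<Rightarrow> 'a \<times> 'b \<Rightarrow> complex"
  where "cinner_prod x y = cinner (fst x) (fst y) + cinner (snd x) (snd y)"

instance
proof
  fix x y :: "'a \<times> 'b"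
  show "cinner x y = cnj (cinner y x)"
    unfolding cinner_prod_def complex_cnj_add
    by (metis cinner_commute)
qed (auto simp: scaleC_prod_def cinner_prod_def scaleC_add_right scaleC_add_left scaleC_scaleC
    scaleC_one scaleR_eq_scaleC scaleR_prod_def cinner_add_left cinner_scaleC_left
    inner_prod_def inner_eq_Re_cinner algebra_simps)

end

instance prod :: (complex_hilbert, complex_hilbert) complex_hilbert ..


section \<open>Bounded operators\<close>

definition complex_linear :: "('a::complex_inner \<Rightarrow> 'b::complex_inner) \<Rightarrow> bool"
  where "complex_linear A \<longleftrightarrow>
    (\<forall>x y. A (x + y) = A x + A y) \<and> (\<forall>c x. A (c *\<^sub>C x) = c *\<^sub>C A x)"

text \<open>
  An element of the space \<open>B(H, K)\<close> is an \<open>A :: 'h \<Rightarrow>\<^sub>L 'k\<close> (bounded and real linear) that is moreover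
  complex linear. The real and the complex operator norm of such an \<open>A\<close> are the same supremum.
\<close>

definition adj :: "('a::complex_hilbert \<Rightarrow>\<^sub>L 'b::complex_hilbert) \<Rightarrow> ('b \<Rightarrow>\<^sub>L 'a)"
  where "adj A = (THE B :: 'b \<Rightarrow>\<^sub>L 'a. \<forall>x y. cinner (A x) y = cinner x (B y))"

definition spectrum :: "('a::complex_hilbert \<Rightarrow>\<^sub>L 'a) \<Rightarrow> complex set"
  where "spectrum A =
    {z. \<not> (\<exists>B :: 'a \<Rightarrow>\<^sub>L 'a. \<forall>x. B (A x - z *\<^sub>C x) = x \<and> A (B x) - z *\<^sub>C B x = x)}"

definition op_poly :: "real poly \<Rightarrow> ('a::real_normed_vector \<Rightarrow>\<^sub>L 'a) \<Rightarrow> ('a \<Rightarrow>\<^sub>L 'a)"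
  where "op_poly p A = (\<Sum>i\<le>degree p. coeff p i *\<^sub>R ((\<lambda>B. A o\<^sub>L B) ^^ i) id_blinfun)"

text \<open>
  Continuous functional calculus \<open>f(A)\<close> of a self-adjoint operator \<open>A\<close> and a real function \<open>f\<close> that is
  continuous on the spectrum: the norm limit of \<open>p\<^sub>n(A)\<close> for polynomials \<open>p\<^sub>n\<close> converging to \<open>f\<close>
  uniformly on the spectrum. As \<open>A\<close> is self-adjoint its spectrum is real, so restricting to the real
  points of the spectrum loses nothing, and real polynomials suffice.
\<close>

definition cfc :: "(real \<Rightarrow> real) \<Rightarrow> ('a::complex_hilbert \<Rightarrow>\<^sub>L 'a) \<Rightarrow> ('a \<Rightarrow>\<^sub>L 'a)"
  where "cfc f A = (THE B. \<exists>p :: nat \<Rightarrow> real poly.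
      uniform_limit {t. complex_of_real t \<in> spectrum A} (\<lambda>n. poly (p n)) f sequentially \<and>
      (\<lambda>n. op_poly (p n) A) \<longlonglongrightarrow> B)"

definition op_abs :: "('a::complex_hilbert \<Rightarrow>\<^sub>L 'b::complex_hilbert) \<Rightarrow> ('a \<Rightarrow>\<^sub>L 'a)"
  where "op_abs A = cfc sqrt (adj A o\<^sub>L A)"

definition op_powr :: "('a::complex_hilbert \<Rightarrow>\<^sub>L 'a) \<Rightarrow> real \<Rightarrow> ('a \<Rightarrow>\<^sub>L 'a)"
  where "op_powr A s = cfc (\<lambda>t. t powr s) A"

definition block_op ::
  "('a::complex_hilbert \<Rightarrow>\<^sub>L 'a) \<Rightarrow> ('b::complex_hilbert \<Rightarrow>\<^sub>L 'a) \<Rightarrow>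
   ('a \<Rightarrow>\<^sub>L 'b) \<Rightarrow> ('b \<Rightarrow>\<^sub>L 'b) \<Rightarrow> (('a \<times> 'b) \<Rightarrow>\<^sub>L ('a \<times> 'b))"
  where "block_op A B C D = Blinfun (\<lambda>v. (A (fst v) + B (snd v), C (fst v) + D (snd v)))"

lemma block_op_apply [simp]:
  "block_op A B C D (x, y) = (A x + B y, C x + D y)"
proof -
  have "bounded_linear (\<lambda>v. (A (fst v) + B (snd v), C (fst v) + D (snd v)))"
    by (intro bounded_linear_Pair bounded_linear_add bounded_linear_compose[OF blinfun.bounded_linear_right]
        bounded_linear_fst bounded_linear_snd)
  then show ?thesis
    by (simp add: block_op_def bounded_linear_Blinfun_apply)
qed


section \<open>Functional Hilbert spaces and Berezin numbers\<close>

text \<open>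
  \<open>ev h l\<close> is the value at \<open>l\<close> of the function \<open>h\<close>.
\<close>

definition rkernel :: "('h::complex_hilbert \<Rightarrow> 'a \<Rightarrow> complex) \<Rightarrow> 'a \<Rightarrow> 'h"
  where "rkernel ev l = (THE k. \<forall>h. ev h l = cinner h k)"

text \<open>
  A Hilbert space of functions on \<open>\<Omega>\<close> is given as a Hilbert space type together with the map \<open>ev\<close> taking
  an element to its function of values; on \<open>\<Omega>\<close> this map is injective and linear (for the pointwise
  operations on functions).
\<close>

locale functional_hilbert_space =
  fixes \<Omega> :: "'a set" and ev :: "'h::complex_hilbert \<Rightarrow> 'a \<Rightarrow> complex"
  assumes nonempty: "\<Omega> \<noteq> {}"
    and ev_inject: "\<And>h h'. (\<forall>l\<in>\<Omega>. ev h l = ev h' l) \<Longrightarrow> h = h'"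
    and ev_linear: "\<And>l. l \<in> \<Omega> \<Longrightarrow> complex_linear (\<lambda>h. ev h l)"
    and ev_continuous: "\<And>l. l \<in> \<Omega> \<Longrightarrow> continuous_on UNIV (\<lambda>h. ev h l)"
    and rkernel_nonzero: "\<And>l. l \<in> \<Omega> \<Longrightarrow> rkernel ev l \<noteq> 0"

text \<open>
  Berezin symbol and number with respect to a family \<open>k\<close> of nonzero kernel vectors indexed by \<open>\<Omega>\<close>, so
  that they apply both to a functional Hilbert space and to a direct sum of two of them.
\<close>

definition berezin_symbol :: "('a \<Rightarrow> 'h::complex_hilbert) \<Rightarrow> ('h \<Rightarrow>\<^sub>L 'h) \<Rightarrow> 'a \<Rightarrow> complex"
  where "berezin_symbol k A l =
    (let u = k l /\<^sub>R norm (k l) in cinner (A u) u)"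

definition ber :: "'a set \<Rightarrow> ('a \<Rightarrow> 'h::complex_hilbert) \<Rightarrow> ('h \<Rightarrow>\<^sub>L 'h) \<Rightarrow> real"
  where "ber \<Omega> k A = (SUP l\<in>\<Omega>. cmod (berezin_symbol k A l))"

definition sum_kernel ::
  "('a \<Rightarrow> 'h::complex_hilbert) \<Rightarrow> ('b \<Rightarrow> 'k::complex_hilbert) \<Rightarrow> 'a \<times> 'b \<Rightarrow> 'h \<times> 'k"
  where "sum_kernel k1 k2 l = (k1 (fst l), k2 (snd l))"

end

theory Submission
  imports Defs "HOL-Computational_Algebra.Fundamental_Theorem_Algebra"
begin

text \<open>
  At a pair of kernels the symbol of \<open>T\<close> is \<open>(\<langle>X k2, k1\<rangle> + \<langle>Y k1, k2\<rangle>) / (\<parallel>k1\<parallel>\<^sup>2 + \<parallel>k2\<parallel>\<^sup>2)\<close>.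
  The mixed Schwarz inequality \<open>|\<langle>X x, y\<rangle>| \<le> \<parallel>f(|X|) x\<parallel> \<parallel>g(|X*|) y\<parallel>\<close>, convexity of \<open>t \<mapsto> t powr r\<close>,
  the Cauchy--Schwarz inequality in the plane and McCarthy's inequality
  \<open>\<parallel>A u\<parallel> powr (2 * r) \<le> \<langle>A powr (2 * r) u, u\<rangle>\<close> for unit \<open>u\<close> and \<open>A \<ge> 0\<close> give the bound;
  the second inequality arises by exchanging \<open>f\<close> and \<open>g\<close> for \<open>Y\<close>.

  Only real spectral points enter the functional calculus, so it needs only the real Hilbert
  space structure. It rests on the fact that a real polynomial that is nonnegative on the real spectrum
  of a self-adjoint \<open>A\<close> is nonnegative at \<open>A\<close>: the infimum \<open>m\<close> of the numerical range of \<open>p(A)\<close> makes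
  \<open>p(A) - m\<close> not invertible, and splitting \<open>p - m\<close> into real linear and quadratic factors
  yields a spectral point \<open>t\<close> with \<open>p(t) = m\<close>.
\<close>

instance complex_hilbert \<subseteq> banach ..

section \<open>Invertible and self-adjoint operators\<close>

text \<open>As in \<open>spectrum\<close>, the inverse is only asked to be bounded and real linear,
  so the notion makes sense in real spaces.\<close>

definition op_invertible :: "('a::real_normed_vector \<Rightarrow>\<^sub>L 'a) \<Rightarrow> bool"
  where "op_invertible A \<longleftrightarrow> (\<exists>B :: 'a \<Rightarrow>\<^sub>L 'a. \<forall>x. B (A x) = x \<and> A (B x) = x)"

definition selfadj :: "('a::real_inner \<Rightarrow>\<^sub>L 'a) \<Rightarrow> bool"
  where "selfadj A \<longleftrightarrow> (\<forall>x y. inner (A x) y = inner x (A y))"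

definition op_nonneg :: "('a::real_inner \<Rightarrow>\<^sub>L 'a) \<Rightarrow> bool"
  where "op_nonneg A \<longleftrightarrow> selfadj A \<and> (\<forall>x. 0 \<le> inner (A x) x)"

lemma selfadjD: "selfadj A \<Longrightarrow> inner (A x) y = inner x (A y)"
  by (simp add: selfadj_def)

lemma op_invertible_compose:
  fixes A B :: "'a::real_normed_vector \<Rightarrow>\<^sub>L 'a"
  assumes "op_invertible A" "op_invertible B"
  shows "op_invertible (A o\<^sub>L B)"
proof -
  obtain A' B' :: "'a \<Rightarrow>\<^sub>L 'a" where "\<And>x. A' (A x) = x \<and> A (A' x) = x" "\<And>x. B' (B x) = x \<and> B (B' x) = x"
    using assms unfolding op_invertible_def by metis
  then have "\<forall>x. (B' o\<^sub>L A') ((A o\<^sub>L B) x) = x \<and> (A o\<^sub>L B) ((B' o\<^sub>L A') x) = x"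
    by simp
  then show ?thesis
    unfolding op_invertible_def by blast
qed

text \<open>The real case of the Lax--Milgram lemma: \<open>x \<mapsto> x - e (A x - y)\<close> is a contraction for small \<open>e\<close>.\<close>

lemma coercive_imp_invertible:
  fixes A :: "'a::{real_inner,banach} \<Rightarrow>\<^sub>L 'a"
  assumes c: "c > 0" and co: "\<And>x. c * (norm x)\<^sup>2 \<le> inner (A x) x"
  shows "op_invertible A"
proof -
  define M where "M = norm A + c"
  have M: "M > 0" "c \<le> M" "norm A \<le> M" using c by (auto simp: M_def add_pos_nonneg add.commute)
  \<comment> \<open>This \<open>e\<close> minimises
    \<open>1 - 2 * e * c + e\<^sup>2 * M\<^sup>2\<close>, the bound for the squared contraction
    factor; the minimum \<open>1 - c\<^sup>2 / M\<^sup>2\<close> is nonnegative because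
    \<open>c \<le> M\<close>.\<close>
  define e where "e = c / M\<^sup>2"
  have e: "e > 0" using c M by (simp add: e_def)
  define q where "q = sqrt (1 - c\<^sup>2 / M\<^sup>2)"
  have cM: "0 < c\<^sup>2 / M\<^sup>2" "c\<^sup>2 / M\<^sup>2 \<le> 1"
    using c M by (auto simp: divide_le_eq power_mono)
  have q: "0 \<le> q" "q < 1" using cM by (auto simp: q_def)
  have AM: "norm (A x) \<le> M * norm x" for x
    using norm_blinfun[of A x] M(3) mult_right_mono[OF M(3) norm_ge_zero[of x]] by linarith
  have contr: "norm (x - e *\<^sub>R A x) \<le> q * norm x" for x
  proof (rule power2_le_imp_le)
    have "(norm (x - e *\<^sub>R A x))\<^sup>2 = (norm x)\<^sup>2 - 2 * e * inner (A x) x + e\<^sup>2 * (norm (A x))\<^sup>2"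
      unfolding power2_norm_eq_inner by (simp add: inner_diff inner_commute algebra_simps power2_eq_square)
    also have "\<dots> \<le> (norm x)\<^sup>2 - 2 * e * (c * (norm x)\<^sup>2) + e\<^sup>2 * (M * norm x)\<^sup>2"
      using e by (intro add_mono diff_mono mult_left_mono co power_mono AM) auto
    also have "\<dots> = (1 - c\<^sup>2 / M\<^sup>2) * (norm x)\<^sup>2"
      using M by (simp add: e_def field_simps power2_eq_square)
    also have "\<dots> = (q * norm x)\<^sup>2"
      using cM by (simp add: q_def power_mult_distrib)
    finally show "(norm (x - e *\<^sub>R A x))\<^sup>2 \<le> (q * norm x)\<^sup>2" .
  qed (use q in simp)
  have "\<exists>x. A x = y" for y
  proof -
    have "\<exists>!x. x - e *\<^sub>R (A x - y) = x"
    proof (rule banach_fix_type[OF q], intro allI)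
      fix u v
      have "u - e *\<^sub>R (A u - y) - (v - e *\<^sub>R (A v - y)) = (u - v) - e *\<^sub>R A (u - v)"
        by (simp add: blinfun.diff_right algebra_simps)
      then show "dist (u - e *\<^sub>R (A u - y)) (v - e *\<^sub>R (A v - y)) \<le> q * dist u v"
        using contr[of "u - v"] by (simp only: dist_norm)
    qed
    then show ?thesis using e by auto
  qed
  then obtain B where B: "A (B y) = y" for y by metis
  \<comment> \<open>Coercivity bounds \<open>A\<close> from below, which yields both injectivity and
    the bound on the inverse.\<close>
  have bd: "c * norm x \<le> norm (A x)" for x
  proof (cases "x = 0")
    case False
    have "c * norm x * norm x \<le> norm (A x) * norm x"
      using co[of x] norm_cauchy_schwarz[of "A x" x] by (simp add: power2_eq_square)
    then show ?thesis using False by simp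
  qed simp
  have inj: "x = y" if "A x = A y" for x y
    using bd[of "x - y"] that c by (simp add: blinfun.diff_right mult_le_0_iff)
  have "bounded_linear B"
  proof (rule bounded_linear_intro)
    show "B (x + y) = B x + B y" for x y by (rule inj) (simp add: B blinfun.add_right)
    show "B (r *\<^sub>R x) = r *\<^sub>R B x" for r x by (rule inj) (simp add: B blinfun.scaleR_right)
    show "norm (B x) \<le> norm x * (1 / c)" for x using bd[of "B x"] c by (simp add: B field_simps)
  qed
  then have "\<forall>x. Blinfun B (A x) = x \<and> A (Blinfun B x) = x"
    by (simp add: bounded_linear_Blinfun_apply B inj)
  then show ?thesis unfolding op_invertible_def by blast
qed

lemma exists_unit_inner:
  fixes A :: "'a::real_inner \<Rightarrow>\<^sub>L 'a"
  assumes "inner (A x) x < c * (norm x)\<^sup>2"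
  obtains u where "norm u = 1" "inner (A u) u < c"
proof -
  have x: "norm x > 0" using assms by auto
  show thesis
  proof (rule that[of "x /\<^sub>R norm x"])
    show "norm (x /\<^sub>R norm x) = 1" using x by simp
    show "inner (A (x /\<^sub>R norm x)) (x /\<^sub>R norm x) < c"
      using assms x by (simp add: blinfun.scaleR_right field_simps power2_eq_square)
  qed
qed

lemma numrange_bdd_below:
  fixes A :: "'a::real_inner \<Rightarrow>\<^sub>L 'a"
  shows "bdd_below ((\<lambda>u. inner (A u) u) ` sphere 0 1)"
proof (rule bdd_belowI2)
  fix u :: 'a assume "u \<in> sphere 0 1"
  then show "- norm A \<le> inner (A u) u"
    using Cauchy_Schwarz_ineq2[of "A u" u] norm_blinfun[of A u] by (simp add: abs_le_iff)
qed

text \<open>With \<open>m\<close> the infimum, \<open>D = A - m\<close> is nonnegative, so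
  \<open>(norm (D x))\<^sup>2\<close> is at most a multiple of \<open>inner (D x) x\<close>. A
  bounded inverse would keep \<open>norm (D u)\<close>, hence \<open>inner (D u) u\<close>, away
  from zero on the unit sphere, contradicting the choice of \<open>m\<close>.\<close>

lemma inf_numrange_not_invertible:
  fixes A :: "'a::real_inner \<Rightarrow>\<^sub>L 'a"
  assumes A: "selfadj A" and ne: "sphere (0::'a) 1 \<noteq> {}"
  shows "\<not> op_invertible (A - (INF u\<in>sphere 0 1. inner (A u) u) *\<^sub>R id_blinfun)"
proof
  define m where "m = (INF u\<in>sphere (0::'a) 1. inner (A u) u)"
  define D where "D = A - m *\<^sub>R id_blinfun"
  assume "op_invertible (A - (INF u\<in>sphere 0 1. inner (A u) u) *\<^sub>R id_blinfun)"
  then obtain B :: "'a \<Rightarrow>\<^sub>L 'a" where B: "B (D x) = x" for x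
    unfolding op_invertible_def D_def m_def by metis
  have Dx: "D x = A x - m *\<^sub>R x" for x by (simp add: D_def blinfun.diff_left blinfun.scaleR_left)
  have Ds: "inner (D x) y = inner x (D y)" for x y
    using A by (simp add: Dx selfadj_def inner_diff)
  have Dpos: "0 \<le> inner (D x) x" for x
  proof (rule ccontr)
    assume "\<not> 0 \<le> inner (D x) x"
    then have "inner (A x) x < m * (norm x)\<^sup>2"
      by (simp add: Dx inner_diff power2_norm_eq_inner)
    then obtain u where "norm u = 1" "inner (A u) u < m" by (rule exists_unit_inner)
    then show False
      using cINF_lower[OF numrange_bdd_below, of u A] by (simp add: m_def)
  qed
  define M where "M = norm D + 1"
  have M: "M > 0" by (simp add: M_def add_nonneg_pos)
  have DM: "(norm (D x))\<^sup>2 \<le> M * inner (D x) x" for x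
  proof -
    have "inner (D (D x)) (D x) \<le> norm D * norm (D x) * norm (D x)"
      using norm_cauchy_schwarz[of "D (D x)" "D x"] mult_right_mono[OF norm_blinfun[of D "D x"] norm_ge_zero[of "D x"]]
      by linarith
    also have "\<dots> \<le> M * (norm (D x))\<^sup>2"
      by (simp add: M_def power2_eq_square algebra_simps)
    finally have 1: "inner (D (D x)) (D x) \<le> M * (norm (D x))\<^sup>2" .
    \<comment> \<open>Nonnegativity of \<open>D\<close> is tested at
      \<open>x - s *\<^sub>R D x\<close>; this \<open>s\<close> minimises
      \<open>- 2 * s + s\<^sup>2 * M\<close>.\<close>
    define s where "s = 1 / M"
    have "0 \<le> inner (D (x - s *\<^sub>R D x)) (x - s *\<^sub>R D x)" by (rule Dpos)
    also have "\<dots> = inner (D x) x - 2 * s * (norm (D x))\<^sup>2 + s\<^sup>2 * inner (D (D x)) (D x)"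
      using Ds[of x "D x"] Ds[of "D x" x]
      unfolding power2_norm_eq_inner
      by (simp add: blinfun.diff_right blinfun.scaleR_right inner_diff power2_eq_square algebra_simps)
    also have "\<dots> \<le> inner (D x) x - 2 * s * (norm (D x))\<^sup>2 + s\<^sup>2 * (M * (norm (D x))\<^sup>2)"
      using mult_left_mono[OF 1, of "s\<^sup>2"] by simp
    also have "\<dots> = inner (D x) x - (norm (D x))\<^sup>2 / M"
      using M by (simp add: s_def field_simps power2_eq_square)
    finally show ?thesis using M by (simp add: field_simps)
  qed
  define \<delta> where "\<delta> = 1 / (M * (norm B + 1)\<^sup>2)"
  have nB: "norm B + 1 > 0" by (simp add: add_nonneg_pos)
  have \<delta>: "\<delta> > 0" using M nB by (simp add: \<delta>_def)
  have "m + \<delta> \<le> inner (A u) u" if "u \<in> sphere 0 1" for u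
  proof -
    have u: "norm u = 1" using that by simp
    have "norm (B (D u)) \<le> norm B * norm (D u)" by (rule norm_blinfun)
    then have "1 \<le> (norm B + 1) * norm (D u)" using u norm_ge_zero[of "D u"] unfolding B distrib_right by linarith
    then have "1 \<le> (norm B + 1)\<^sup>2 * (norm (D u))\<^sup>2"
      unfolding power_mult_distrib[symmetric] by (rule one_le_power)
    also have "\<dots> \<le> (norm B + 1)\<^sup>2 * (M * inner (D u) u)"
      by (intro mult_left_mono DM) simp
    finally have "\<delta> \<le> inner (D u) u"
      using M nB by (simp add: \<delta>_def divide_le_eq mult_ac)
    then show ?thesis using u by (simp add: Dx inner_diff dot_square_norm)
  qed
  then have "m + \<delta> \<le> m"
    unfolding m_def by (intro cINF_greatest ne) (auto simp: m_def)
  then show False using \<delta> by simp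
qed

section \<open>Polynomials of a self-adjoint operator\<close>

text \<open>The real points of the spectrum, in a form that speaks of real scalars only.\<close>

definition rspec :: "('a::real_normed_vector \<Rightarrow>\<^sub>L 'a) \<Rightarrow> real set"
  where "rspec A = {t. \<not> op_invertible (A - t *\<^sub>R id_blinfun)}"

lemma op_poly_0 [simp]: "op_poly 0 A = 0"
  by (simp add: op_poly_def)

text \<open>Horner's recursion; it lets the algebraic rules below be proved by induction on the
  polynomial.\<close>

lemma op_poly_pCons: "op_poly (pCons a p) A = a *\<^sub>R id_blinfun + (A o\<^sub>L op_poly p A)"
proof (cases "p = 0")
  case True
  then show ?thesis by (cases "a = 0") (simp_all add: op_poly_def)
next
  case False
  then have "op_poly (pCons a p) A =
      a *\<^sub>R id_blinfun + (\<Sum>i\<le>degree p. coeff p i *\<^sub>R (A o\<^sub>L ((\<lambda>B. A o\<^sub>L B) ^^ i) id_blinfun))"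
    by (simp add: op_poly_def sum.atMost_Suc_shift del: sum.atMost_Suc)
  then show ?thesis
    by (simp add: op_poly_def bounded_bilinear.sum_right[OF bounded_bilinear_blinfun_compose]
        bounded_bilinear.scaleR_right[OF bounded_bilinear_blinfun_compose])
qed

lemma op_poly_pCons_apply: "op_poly (pCons a p) A x = a *\<^sub>R x + A (op_poly p A x)"
  by (simp add: op_poly_pCons blinfun.add_left blinfun.scaleR_left)

lemma op_poly_const: "op_poly [:c:] A = c *\<^sub>R id_blinfun"
  by (rule blinfun_eqI) (simp add: op_poly_pCons_apply blinfun.scaleR_left)

lemma op_poly_add: "op_poly (p + q) A = op_poly p A + op_poly q A"
  by (rule blinfun_eqI, induct p q rule: poly_induct2)
    (simp_all add: op_poly_pCons_apply blinfun.add_left blinfun.add_right algebra_simps)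

lemma op_poly_smult: "op_poly (smult c p) A = c *\<^sub>R op_poly p A"
  by (rule blinfun_eqI, induct p)
    (simp_all add: op_poly_pCons_apply blinfun.scaleR_left blinfun.scaleR_right algebra_simps)

lemma op_poly_minus: "op_poly (- p) A = - op_poly p A"
  using op_poly_smult[of "-1" p A] by simp

lemma op_poly_diff: "op_poly (p - q) A = op_poly p A - op_poly q A"
  using op_poly_add[of p "- q" A] by (simp add: op_poly_minus)

lemma op_poly_mult: "op_poly (p * q) A = op_poly p A o\<^sub>L op_poly q A"
  by (rule blinfun_eqI, induct p)
    (simp_all add: op_poly_pCons_apply op_poly_add op_poly_smult blinfun.add_left
      blinfun.scaleR_left)

text \<open>The case \<open>S = B = A\<close> says that \<open>A\<close> commutes with its
  polynomials; the case of different spaces is the seed of \<open>cfc_intertwine\<close>.\<close>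

lemma op_poly_intertwine:
  fixes S :: "'a::real_normed_vector \<Rightarrow>\<^sub>L 'b::real_normed_vector"
    and A :: "'a \<Rightarrow>\<^sub>L 'a" and B :: "'b \<Rightarrow>\<^sub>L 'b"
  assumes "\<And>x. S (A x) = B (S x)"
  shows "S (op_poly p A x) = op_poly p B (S x)"
  by (induct p) (simp_all add: op_poly_pCons_apply blinfun.add_right blinfun.scaleR_right assms)

lemma selfadj_op_poly:
  assumes "selfadj A"
  shows "selfadj (op_poly p A)"
proof (induct p)
  case (pCons a p)
  have "inner (A (op_poly p A x)) y = inner x (A (op_poly p A y))" for x y
    using op_poly_intertwine[of A A A p] pCons assms by (simp add: selfadj_def)
  then show ?case
    by (simp add: selfadj_def op_poly_pCons_apply inner_add)
qed (simp add: selfadj_def)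

section \<open>Factorisation of real polynomials and invertibility\<close>

lemma poly_of_real_map_add:
  "poly (map_poly of_real (p + q)) z
    = poly (map_poly of_real p) z + poly (map_poly of_real q) (z::complex)"
  by (induct p q rule: poly_induct2) (simp_all add: map_poly_pCons algebra_simps)

lemma poly_of_real_map_mult:
  "poly (map_poly of_real (p * q)) z
    = poly (map_poly of_real p) z * poly (map_poly of_real q) (z::complex)"
proof -
  have smult: "poly (map_poly of_real (smult c q)) z
      = of_real c * poly (map_poly of_real q) z" for c and q :: "real poly"
    by (induct q) (simp_all add: map_poly_pCons algebra_simps)
  show ?thesis
    by (induct p) (simp_all add: map_poly_pCons poly_of_real_map_add smult algebra_simps)
qed

text \<open>Take a complex root \<open>z\<close>. If it is real, it splits off a linear factor;
  otherwise the real quadratic with roots \<open>z\<close> and \<open>cnj z\<close> divides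
  \<open>q\<close>, because the remainder also vanishes at \<open>z\<close>.\<close>

lemma real_poly_factor:
  fixes q :: "real poly"
  assumes "degree q > 0"
  obtains t s where "q = [:- t, 1:] * s"
  | a b s where "b \<noteq> 0" "q = [:a\<^sup>2 + b\<^sup>2, - 2 * a, 1:] * s"
proof -
  have "degree (map_poly complex_of_real q) = degree q"
    by (rule degree_map_poly) simp
  then obtain z where z: "poly (map_poly complex_of_real q) z = 0"
    using fundamental_theorem_of_algebra assms constant_degree by (metis less_numeral_extra(3))
  define a b where "a = Re z" and "b = Im z"
  show thesis
  proof (cases "b = 0")
    case True
    then have "z = of_real a" by (simp add: a_def b_def complex_eq_iff)
    moreover have "poly (map_poly of_real q) (complex_of_real a) = of_real (poly q a)"
      by (induct q) (simp_all add: map_poly_pCons)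
    ultimately have "poly q a = 0" using z by simp
    then show thesis using that(1) by (metis dvdE poly_eq_0_iff_dvd)
  next
    case False
    define d where "d = [:a\<^sup>2 + b\<^sup>2, - 2 * a, 1:]"
    obtain c p where p: "q mod d = pCons c p" by (cases "q mod d")
    have "degree p = 0"
    proof (cases "p = 0")
      case False
      have "degree (pCons c p) < degree d"
        unfolding p[symmetric] by (rule degree_mod_less') (use False p in \<open>auto simp: d_def\<close>)
      then show ?thesis using False by (simp add: d_def)
    qed simp
    then obtain e where ce: "q mod d = [:c, e:]" using p by (metis degree_eq_zeroE)
    have "poly (map_poly of_real d) z = 0"
      by (simp add: d_def map_poly_pCons a_def b_def complex_eq_iff power2_eq_square algebra_simps)
    then have "poly (map_poly of_real (q mod d)) z = 0"
      using z poly_of_real_map_add[of "q div d * d" "q mod d" z]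
      by (simp add: poly_of_real_map_mult)
    \<comment> \<open>A real affine polynomial that vanishes at a non-real point is zero.\<close>
    then have "e = 0" "c = 0"
      using False by (auto simp: ce map_poly_pCons complex_eq_iff a_def b_def)
    then have "q = d * (q div d)" using div_mult_mod_eq[of q d] by (simp add: ce mult.commute)
    then show thesis using that(2) False by (metis d_def)
  qed
qed

text \<open>Induction on the degree, splitting off one real factor at a time. A linear factor is
  invertible because its root lies outside \<open>rspec A\<close>, a quadratic one because it is
  coercive.\<close>

lemma op_poly_invertible:
  fixes A :: "'a::{real_inner,banach} \<Rightarrow>\<^sub>L 'a"
  assumes A: "selfadj A" and "q \<noteq> 0" "\<And>t. t \<in> rspec A \<Longrightarrow> poly q t \<noteq> 0"
  shows "op_invertible (op_poly q A)"
  using assms(2,3)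
proof (induct "degree q" arbitrary: q rule: less_induct)
  case less
  show ?case
  proof (cases "degree q = 0")
    case True
    then obtain c where c: "q = [:c:]" by (metis degree_eq_zeroE)
    then have "c \<noteq> 0" using less by simp
    then have "\<forall>x. ((1/c) *\<^sub>R id_blinfun) (op_poly q A x) = x \<and> op_poly q A (((1/c) *\<^sub>R id_blinfun) x) = x"
      by (simp add: c op_poly_const blinfun.scaleR_left)
    then show ?thesis unfolding op_invertible_def by blast
  next
    case False
    then have "degree q > 0" by simp
    then show ?thesis
    proof (cases rule: real_poly_factor)
      case (1 t s)
      have s: "s \<noteq> 0" using 1 less.prems(1) by auto
      have "op_invertible (op_poly s A)"
      proof (rule less.hyps)
        show "degree s < degree q" using s by (simp add: 1 degree_mult_eq del: mult_pCons_left)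
      qed (use s less.prems(2) 1 in auto)
      moreover have "op_poly [:- t, 1:] A = A - t *\<^sub>R id_blinfun"
        by (rule blinfun_eqI) (simp add: op_poly_pCons_apply blinfun.diff_left blinfun.scaleR_left)
      moreover have "t \<notin> rspec A" using less.prems(2)[of t] 1 by auto
      ultimately show ?thesis
        unfolding 1 op_poly_mult by (intro op_invertible_compose) (simp_all add: rspec_def)
    next
      case (2 a b s)
      have s: "s \<noteq> 0" using 2 less.prems(1) by auto
      have "op_invertible (op_poly s A)"
      proof (rule less.hyps)
        show "degree s < degree q" using s by (simp add: 2(2) degree_mult_eq del: mult_pCons_left)
        show "poly s t \<noteq> 0" if "t \<in> rspec A" for t
          using less.prems(2)[OF that] by (auto simp: 2(2) simp del: mult_pCons_left)
      qed (rule s)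
      moreover have "op_invertible (op_poly [:a\<^sup>2 + b\<^sup>2, - 2 * a, 1:] A)"
      proof (rule coercive_imp_invertible)
        show "b\<^sup>2 > 0" using 2 by simp
        fix x
        \<comment> \<open>The quadratic is \<open>(t - a)\<^sup>2 + b\<^sup>2\<close>;
          self-adjointness turns the square into a squared norm.\<close>
        have "inner (op_poly [:a\<^sup>2 + b\<^sup>2, - 2 * a, 1:] A x) x = b\<^sup>2 * (norm x)\<^sup>2 + (norm (A x - a *\<^sub>R x))\<^sup>2"
          using selfadjD[OF A, of "A x" x] inner_commute[of x "A x"]
          unfolding power2_norm_eq_inner
          by (simp add: op_poly_pCons_apply inner_add inner_diff
              power2_eq_square blinfun.add_right blinfun.diff_right blinfun.scaleR_right algebra_simps)
        then show "b\<^sup>2 * (norm x)\<^sup>2 \<le> inner (op_poly [:a\<^sup>2 + b\<^sup>2, - 2 * a, 1:] A x) x" by simp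
      qed
      ultimately show ?thesis
        unfolding 2(2) op_poly_mult by (intro op_invertible_compose) simp_all
    qed
  qed
qed

lemma op_poly_nonneg:
  fixes A :: "'a::{real_inner,banach} \<Rightarrow>\<^sub>L 'a"
  assumes A: "selfadj A" and p: "\<And>t. t \<in> rspec A \<Longrightarrow> poly p t \<ge> 0"
  shows "inner (op_poly p A x) x \<ge> 0"
proof (rule ccontr)
  assume "\<not> ?thesis"
  then have "inner (op_poly p A x) x < 0 * (norm x)\<^sup>2" by simp
  then obtain u where u: "norm u = 1" "inner (op_poly p A u) u < 0" by (rule exists_unit_inner)
  have ne: "sphere (0::'a) 1 \<noteq> {}" using u by auto
  define m where "m = (INF u\<in>sphere (0::'a) 1. inner (op_poly p A u) u)"
  have "m < 0"
    using cINF_lower[OF numrange_bdd_below, of u "op_poly p A"] u by (simp add: m_def)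
  have "op_poly (p - [:m:]) A = op_poly p A - m *\<^sub>R id_blinfun"
    by (simp only: op_poly_diff op_poly_const)
  then have ninv: "\<not> op_invertible (op_poly (p - [:m:]) A)"
    using inf_numrange_not_invertible[OF selfadj_op_poly[OF A] ne, of p] by (simp add: m_def)
  \<comment> \<open>A point of the real spectrum is needed to see that \<open>p - [:m:]\<close> is
    not the zero polynomial, as \<open>op_poly_invertible\<close> requires.\<close>
  obtain t0 where t0: "t0 \<in> rspec A"
    using inf_numrange_not_invertible[OF A ne] by (auto simp: rspec_def)
  have "poly (p - [:m:]) t0 > 0" using p[OF t0] \<open>m < 0\<close> by simp
  then have "p - [:m:] \<noteq> 0" by (metis less_irrefl poly_0)
  then obtain t where "t \<in> rspec A" "poly (p - [:m:]) t = 0"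
    using op_poly_invertible[OF A] ninv by blast
  then show False using p[of t] \<open>m < 0\<close> by simp
qed

text \<open>Apply \<open>op_poly_nonneg\<close> to \<open>e\<^sup>2 - p\<^sup>2\<close>; since
  \<open>p(A)\<close> is self-adjoint, the result bounds
  \<open>norm (op_poly p A x)\<close>.\<close>

lemma norm_op_poly_le:
  fixes A :: "'a::{real_inner,banach} \<Rightarrow>\<^sub>L 'a"
  assumes A: "selfadj A" and e: "e \<ge> 0" and p: "\<And>t. t \<in> rspec A \<Longrightarrow> \<bar>poly p t\<bar> \<le> e"
  shows "norm (op_poly p A) \<le> e"
proof (rule norm_blinfun_bound[OF e])
  fix x
  have "0 \<le> inner (op_poly ([:e\<^sup>2:] - p * p) A x) x"
  proof (rule op_poly_nonneg[OF A])
    fix t assume "t \<in> rspec A"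
    from power_mono[OF p[OF this], of 2] show "poly ([:e\<^sup>2:] - p * p) t \<ge> 0"
      by (simp add: power2_eq_square)
  qed
  also have "\<dots> = e\<^sup>2 * (norm x)\<^sup>2 - (norm (op_poly p A x))\<^sup>2"
    by (simp add: op_poly_diff op_poly_const op_poly_mult blinfun.diff_left blinfun.scaleR_left
        inner_diff power2_norm_eq_inner selfadjD[OF selfadj_op_poly[OF A], of p "op_poly p A x" x])
  finally have "(norm (op_poly p A x))\<^sup>2 \<le> (e * norm x)\<^sup>2"
    by (simp add: power_mult_distrib)
  then show "norm (op_poly p A x) \<le> e * norm x"
    by (rule power2_le_imp_le) (use e in simp)
qed

section \<open>Continuous functional calculus\<close>

lemma continuous_poly_approx:
  fixes f :: "real \<Rightarrow> real"
  assumes "continuous_on {a..b} f"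
  obtains p :: "nat \<Rightarrow> real poly" where "uniform_limit {a..b} (\<lambda>n. poly (p n)) f sequentially"
proof -
  have "\<exists>p. \<forall>t\<in>{a..b}. \<bar>f t - poly p t\<bar> < 1 / real (Suc n)" for n
  proof -
    obtain h where h: "real_polynomial_function h" "\<And>t. t \<in> {a..b} \<Longrightarrow> \<bar>f t - h t\<bar> < 1 / real (Suc n)"
      using Stone_Weierstrass_real_polynomial_function[OF compact_Icc assms, of "1 / real (Suc n)"]
      by auto
    then obtain c N where "h = (\<lambda>t. \<Sum>i\<le>N. c i * t ^ i)"
      unfolding real_polynomial_function_iff_sum by blast
    then have "h t = poly (\<Sum>i\<le>N. monom (c i) i) t" for t
      by (simp add: poly_sum poly_monom)
    then show ?thesis using h(2) by metis
  qed
  then obtain p where p: "\<And>n t. t \<in> {a..b} \<Longrightarrow> \<bar>f t - poly (p n) t\<bar> < 1 / real (Suc n)"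
    by metis
  have "uniform_limit {a..b} (\<lambda>n. poly (p n)) f sequentially"
  proof (rule uniform_limitI)
    fix e :: real assume "e > 0"
    from order_tendstoD(2)[OF LIMSEQ_inverse_real_of_nat this]
    show "\<forall>\<^sub>F n in sequentially. \<forall>t\<in>{a..b}. dist (poly (p n) t) (f t) < e"
    proof eventually_elim
      case (elim n)
      then show ?case using p[of _ n] by (force simp: dist_real_def abs_minus_commute inverse_eq_divide)
    qed
  qed
  then show thesis by (rule that)
qed

text \<open>The property that singles out \<open>cfc f A\<close>, as a relation: its algebra can be
  developed before existence and uniqueness of the value are settled.\<close>

definition cfc_rel ::
  "(real \<Rightarrow> real) \<Rightarrow> ('a::{real_inner,banach} \<Rightarrow>\<^sub>L 'a) \<Rightarrow> ('a \<Rightarrow>\<^sub>L 'a) \<Rightarrow> bool"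
  where "cfc_rel f A B \<longleftrightarrow> (\<exists>p. uniform_limit (rspec A) (\<lambda>n. poly (p n)) f sequentially \<and>
      (\<lambda>n. op_poly (p n) A) \<longlonglongrightarrow> B)"

text \<open>By \<open>norm_op_poly_le\<close>, a sequence of polynomials that is uniformly Cauchy on
  the real spectrum gives operators that are Cauchy in norm.\<close>

lemma op_poly_convergent:
  fixes A :: "'a::{real_inner,banach} \<Rightarrow>\<^sub>L 'a"
  assumes A: "selfadj A" and p: "uniform_limit (rspec A) (\<lambda>n. poly (p n)) f sequentially"
  shows "convergent (\<lambda>n. op_poly (p n) A)"
  unfolding Cauchy_convergent_iff[symmetric]
proof (rule CauchyI)
  fix e :: real assume e: "e > 0"
  from uniform_limitD[OF p, of "e/4"] e
  obtain N where N: "\<And>n t. n \<ge> N \<Longrightarrow> t \<in> rspec A \<Longrightarrow> \<bar>poly (p n) t - f t\<bar> < e/4"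
    by (auto simp: eventually_sequentially dist_real_def)
  have "norm (op_poly (p m) A - op_poly (p n) A) < e" if "m \<ge> N" "n \<ge> N" for m n
  proof -
    have "norm (op_poly (p m - p n) A) \<le> e/2"
    proof (rule norm_op_poly_le[OF A])
      fix t assume "t \<in> rspec A"
      from N[OF that(1) this] N[OF that(2) this]
      show "\<bar>poly (p m - p n) t\<bar> \<le> e/2" by (simp add: abs_if split: if_splits)
    qed (use e in simp)
    then show ?thesis using e by (simp add: op_poly_diff)
  qed
  then show "\<exists>M. \<forall>m\<ge>M. \<forall>n\<ge>M. norm (op_poly (p m) A - op_poly (p n) A) < e" by blast
qed

text \<open>The bound of \<open>norm_op_poly_le\<close> passes to the limit; the slack
  \<open>d\<close> absorbs the distance from \<open>f\<close> to its approximants.\<close>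

lemma cfc_rel_norm_le:
  assumes A: "selfadj A" and r: "cfc_rel f A B" and f: "\<And>t. t \<in> rspec A \<Longrightarrow> \<bar>f t\<bar> \<le> e" and e: "e \<ge> 0"
  shows "norm B \<le> e"
proof (rule field_le_epsilon)
  fix d :: real assume d: "d > 0"
  obtain p where p: "uniform_limit (rspec A) (\<lambda>n. poly (p n)) f sequentially"
    "(\<lambda>n. op_poly (p n) A) \<longlonglongrightarrow> B"
    using r unfolding cfc_rel_def by blast
  have "\<forall>\<^sub>F n in sequentially. norm (op_poly (p n) A) \<le> e + d"
    using uniform_limitD[OF p(1) d]
  proof eventually_elim
    case (elim n)
    show ?case
    proof (rule norm_op_poly_le[OF A])
      fix t assume t: "t \<in> rspec A"
      show "\<bar>poly (p n) t\<bar> \<le> e + d"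
        using f[OF t] bspec[OF elim t] by (auto simp: dist_real_def abs_if split: if_splits)
    qed (use e d in simp)
  qed
  then show "norm B \<le> e + d"
    by (rule tendsto_upperbound[OF tendsto_norm[OF p(2)]]) simp
qed

lemma cfc_rel_add:
  assumes "cfc_rel f A B" "cfc_rel g A C"
  shows "cfc_rel (\<lambda>t. f t + g t) A (B + C)"
proof -
  obtain p q where "uniform_limit (rspec A) (\<lambda>n. poly (p n)) f sequentially"
    "(\<lambda>n. op_poly (p n) A) \<longlonglongrightarrow> B" "uniform_limit (rspec A) (\<lambda>n. poly (q n)) g sequentially"
    "(\<lambda>n. op_poly (q n) A) \<longlonglongrightarrow> C"
    using assms unfolding cfc_rel_def by blast
  then show ?thesis unfolding cfc_rel_def
    by (intro exI[of _ "\<lambda>n. p n + q n"])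
      (simp add: op_poly_add tendsto_add poly_add[abs_def] uniform_limit_add)
qed

lemma cfc_rel_poly: "cfc_rel (poly p) A (op_poly p A)"
  unfolding cfc_rel_def by (intro exI[of _ "\<lambda>n. p"]) (auto intro: uniform_limit_const)

text \<open>Boundedness on the real spectrum is what allows uniform limits to be multiplied.\<close>

lemma cfc_rel_mult:
  assumes "cfc_rel f A B" "cfc_rel g A C" "bounded (f ` rspec A)" "bounded (g ` rspec A)"
  shows "cfc_rel (\<lambda>t. f t * g t) A (B o\<^sub>L C)"
proof -
  obtain p q where p: "uniform_limit (rspec A) (\<lambda>n. poly (p n)) f sequentially"
    "(\<lambda>n. op_poly (p n) A) \<longlonglongrightarrow> B" and q: "uniform_limit (rspec A) (\<lambda>n. poly (q n)) g sequentially"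
    "(\<lambda>n. op_poly (q n) A) \<longlonglongrightarrow> C"
    using assms unfolding cfc_rel_def by blast
  have "uniform_limit (rspec A) (\<lambda>n. poly (p n * q n)) (\<lambda>t. f t * g t) sequentially"
    using uniform_lim_mult[OF p(1) q(1) assms(3,4)] by (simp add: poly_mult[abs_def])
  moreover have "(\<lambda>n. op_poly (p n * q n) A) \<longlonglongrightarrow> (B o\<^sub>L C)"
    unfolding op_poly_mult
    by (rule bounded_bilinear.tendsto[OF bounded_bilinear_blinfun_compose p(2) q(2)])
  ultimately show ?thesis unfolding cfc_rel_def by (intro exI[of _ "\<lambda>n. p n * q n"] conjI)
qed

lemma cfc_rel_scale:
  assumes "cfc_rel f A B"
  shows "cfc_rel (\<lambda>t. c * f t) A (c *\<^sub>R B)"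
proof -
  obtain p where p: "uniform_limit (rspec A) (\<lambda>n. poly (p n)) f sequentially"
    "(\<lambda>n. op_poly (p n) A) \<longlonglongrightarrow> B"
    using assms unfolding cfc_rel_def by blast
  have "uniform_limit (rspec A) (\<lambda>n. poly (smult c (p n))) (\<lambda>t. c * f t) sequentially"
    using bounded_linear.uniform_limit[OF bounded_linear_mult_right p(1), of c]
    by (simp add: poly_smult[abs_def])
  then show ?thesis unfolding cfc_rel_def
    by (intro exI[of _ "\<lambda>n. smult c (p n)"]) (auto simp: op_poly_smult intro: tendsto_scaleR p)
qed

text \<open>The difference of two values belongs to the zero function, so its norm is zero.\<close>

lemma cfc_rel_unique:
  assumes A: "selfadj A" and "cfc_rel f A B" "cfc_rel f A C"
  shows "B = C"
proof -
  have "cfc_rel (\<lambda>t. f t + (-1) * f t) A (B + (-1) *\<^sub>R C)"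
    by (intro cfc_rel_add cfc_rel_scale assms)
  then have "norm (B + (-1) *\<^sub>R C) \<le> 0"
    by (rule cfc_rel_norm_le[OF A]) simp_all
  then show ?thesis by simp
qed

lemma cfc_rel_inner_nonneg:
  assumes A: "selfadj A" and r: "cfc_rel f A B" and f: "\<And>t. t \<in> rspec A \<Longrightarrow> f t \<ge> 0"
  shows "inner (B x) x \<ge> 0"
proof -
  obtain p where p: "uniform_limit (rspec A) (\<lambda>n. poly (p n)) f sequentially"
    "(\<lambda>n. op_poly (p n) A) \<longlonglongrightarrow> B"
    using r unfolding cfc_rel_def by blast
  have lim: "(\<lambda>n. inner (op_poly (p n) A x) x) \<longlonglongrightarrow> inner (B x) x"
    by (intro tendsto_intros p(2))
  have "0 \<le> inner (B x) x + d" if d: "d > 0" for d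
  proof -
    \<comment> \<open>The approximants may be slightly negative on the spectrum. Raising them by
      \<open>d'\<close> repairs this at a cost \<open>d' * (norm x)\<^sup>2 \<le> d\<close>; the
      \<open>+ 1\<close> covers \<open>x = 0\<close>.\<close>
    define d' where "d' = d / ((norm x)\<^sup>2 + 1)"
    have d': "d' > 0" using d by (simp add: d'_def add_nonneg_pos)
    have "d' * (norm x)\<^sup>2 \<le> d' * ((norm x)\<^sup>2 + 1)" using d' by simp
    also have "\<dots> = d" unfolding d'_def by (simp add: add_nonneg_eq_0_iff)
    finally have dx: "d' * (norm x)\<^sup>2 \<le> d" .
    have "\<forall>\<^sub>F n in sequentially. - d \<le> inner (op_poly (p n) A x) x"
      using uniform_limitD[OF p(1) d']
    proof eventually_elim
      case (elim n)
      have "0 \<le> inner (op_poly (p n + [:d':]) A x) x"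
      proof (rule op_poly_nonneg[OF A])
        fix t assume t: "t \<in> rspec A"
        show "0 \<le> poly (p n + [:d':]) t"
          using f[OF t] bspec[OF elim t] by (auto simp: dist_real_def abs_if split: if_splits)
      qed
      then have "0 \<le> inner (op_poly (p n) A x) x + d' * (norm x)\<^sup>2"
        by (simp add: op_poly_add op_poly_const blinfun.add_left blinfun.scaleR_left inner_add
            power2_norm_eq_inner)
      then show ?case using dx by linarith
    qed
    then have "- d \<le> inner (B x) x" by (rule tendsto_lowerbound[OF lim]) simp
    then show ?thesis by simp
  qed
  then show ?thesis by (rule field_le_epsilon)
qed

lemma cfc_rel_selfadj:
  assumes A: "selfadj A" and r: "cfc_rel f A B"
  shows "selfadj B"
  unfolding selfadj_def
proof (intro allI)
  fix x y
  obtain p where p: "(\<lambda>n. op_poly (p n) A) \<longlonglongrightarrow> B"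
    using r unfolding cfc_rel_def by blast
  have "(\<lambda>n. inner (op_poly (p n) A x) y) \<longlonglongrightarrow> inner (B x) y"
    by (intro tendsto_intros p)
  moreover have "(\<lambda>n. inner (op_poly (p n) A x) y) \<longlonglongrightarrow> inner x (B y)"
    unfolding selfadjD[OF selfadj_op_poly[OF A]] by (intro tendsto_intros p)
  ultimately show "inner (B x) y = inner x (B y)" by (rule LIMSEQ_unique)
qed

section \<open>Functional calculus of nonnegative operators\<close>

lemma op_nonneg_selfadj: "op_nonneg A \<Longrightarrow> selfadj A"
  by (simp add: op_nonneg_def)

text \<open>For \<open>t < 0\<close> the operator \<open>A - t\<close> is coercive, for
  \<open>t > norm A\<close> its negative is.\<close>

lemma rspec_subset:
  fixes A :: "'a::{real_inner,banach} \<Rightarrow>\<^sub>L 'a"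
  assumes A: "op_nonneg A"
  shows "rspec A \<subseteq> {0..norm A}"
proof
  fix t assume t: "t \<in> rspec A"
  have "0 \<le> t"
  proof (rule ccontr)
    assume "\<not> 0 \<le> t"
    then have "op_invertible (A - t *\<^sub>R id_blinfun)"
      using A by (intro coercive_imp_invertible[of "- t"])
        (simp_all add: op_nonneg_def blinfun.diff_left blinfun.scaleR_left inner_diff power2_norm_eq_inner)
    then show False using t by (simp add: rspec_def)
  qed
  moreover have "t \<le> norm A"
  proof (rule ccontr)
    assume less: "\<not> t \<le> norm A"
    have "op_invertible (t *\<^sub>R id_blinfun - A)"
    proof (rule coercive_imp_invertible[of "t - norm A"])
      fix x
      have "inner (A x) x \<le> norm A * norm x * norm x"
        using norm_cauchy_schwarz[of "A x" x] mult_right_mono[OF norm_blinfun[of A x] norm_ge_zero[of x]]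
        by linarith
      moreover have "inner ((t *\<^sub>R id_blinfun - A) x) x = t * (norm x * norm x) - inner (A x) x"
        by (simp add: blinfun.diff_left blinfun.scaleR_left inner_diff norm_eq_sqrt_inner)
      ultimately show "(t - norm A) * (norm x)\<^sup>2 \<le> inner ((t *\<^sub>R id_blinfun - A) x) x"
        by (simp add: power2_eq_square left_diff_distrib mult.assoc)
    qed (use less in simp)
    moreover have "op_invertible (- id_blinfun :: 'a \<Rightarrow>\<^sub>L 'a)"
      unfolding op_invertible_def
      by (rule exI[of _ "- id_blinfun"]) (simp add: blinfun.minus_left)
    ultimately have "op_invertible ((- id_blinfun) o\<^sub>L (t *\<^sub>R id_blinfun - A))"
      by (intro op_invertible_compose)
    also have "(- id_blinfun) o\<^sub>L (t *\<^sub>R id_blinfun - A) = A - t *\<^sub>R id_blinfun"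
      by (rule blinfun_eqI) (simp add: blinfun.minus_left blinfun.diff_left)
    finally show False using t by (simp add: rspec_def)
  qed
  ultimately show "t \<in> {0..norm A}" by simp
qed

text \<open>The bridge from the real theory to \<open>cfc\<close>, whose definition refers to the
  complex spectrum.\<close>

lemma of_real_in_spectrum_iff:
  fixes A :: "'a::complex_hilbert \<Rightarrow>\<^sub>L 'a"
  shows "complex_of_real t \<in> spectrum A \<longleftrightarrow> t \<in> rspec A"
  by (simp add: spectrum_def rspec_def op_invertible_def blinfun.diff_left blinfun.scaleR_left
      scaleR_eq_scaleC)

lemma cfc_eqI:
  fixes A :: "'a::complex_hilbert \<Rightarrow>\<^sub>L 'a"
  assumes "selfadj A" "cfc_rel f A B"
  shows "cfc f A = B"
proof -
  have "cfc f A = (THE B. cfc_rel f A B)"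
    unfolding cfc_def cfc_rel_def of_real_in_spectrum_iff by simp
  also have "\<dots> = B" using assms cfc_rel_unique by blast
  finally show ?thesis .
qed

lemma cfc_tendsto:
  fixes A :: "'a::complex_hilbert \<Rightarrow>\<^sub>L 'a"
  assumes A: "selfadj A" and p: "uniform_limit (rspec A) (\<lambda>n. poly (p n)) f sequentially"
  shows "(\<lambda>n. op_poly (p n) A) \<longlonglongrightarrow> cfc f A"
proof -
  obtain B where B: "(\<lambda>n. op_poly (p n) A) \<longlonglongrightarrow> B"
    using op_poly_convergent[OF A p] by (auto simp: convergent_def)
  then have "cfc f A = B" using p by (intro cfc_eqI A) (auto simp: cfc_rel_def)
  then show ?thesis using B by simp
qed

lemma cfc_rel_cfc:
  fixes A :: "'a::complex_hilbert \<Rightarrow>\<^sub>L 'a"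
  assumes A: "op_nonneg A" and f: "continuous_on {0..} f"
  shows "cfc_rel f A (cfc f A)"
proof -
  have "continuous_on {0..norm A} f" by (rule continuous_on_subset[OF f]) auto
  then obtain p where p: "uniform_limit {0..norm A} (\<lambda>n. poly (p n)) f sequentially"
    by (rule continuous_poly_approx)
  have "uniform_limit (rspec A) (\<lambda>n. poly (p n)) f sequentially"
    by (rule uniform_limit_on_subset[OF p rspec_subset[OF A]])
  then show ?thesis
    using cfc_tendsto[OF op_nonneg_selfadj[OF A]] unfolding cfc_rel_def by blast
qed

text \<open>One sequence of polynomials approximates \<open>f\<close> on an interval containing both
  real spectra, so \<open>op_poly_intertwine\<close> passes to the limit on both sides.\<close>

lemma cfc_intertwine:
  fixes A :: "'a::complex_hilbert \<Rightarrow>\<^sub>L 'a" and B :: "'b::complex_hilbert \<Rightarrow>\<^sub>L 'b"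
    and S :: "'a \<Rightarrow>\<^sub>L 'b"
  assumes A: "op_nonneg A" and B: "op_nonneg B" and f: "continuous_on {0..} f"
    and S: "\<And>x. S (A x) = B (S x)"
  shows "S (cfc f A x) = cfc f B (S x)"
proof -
  define b where "b = max (norm A) (norm B)"
  have "continuous_on {0..b} f" by (rule continuous_on_subset[OF f]) auto
  then obtain p where p: "uniform_limit {0..b} (\<lambda>n. poly (p n)) f sequentially"
    by (rule continuous_poly_approx)
  have "rspec A \<subseteq> {0..b}" "rspec B \<subseteq> {0..b}"
    using rspec_subset[OF A] rspec_subset[OF B] by (auto simp: b_def subset_iff)
  then have lim: "(\<lambda>n. op_poly (p n) A) \<longlonglongrightarrow> cfc f A" "(\<lambda>n. op_poly (p n) B) \<longlonglongrightarrow> cfc f B"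
    using A B by (auto intro!: cfc_tendsto op_nonneg_selfadj uniform_limit_on_subset[OF p])
  have "(\<lambda>n. S (op_poly (p n) A x)) \<longlonglongrightarrow> S (cfc f A x)"
    by (intro tendsto_intros lim)
  moreover have "(\<lambda>n. S (op_poly (p n) A x)) \<longlonglongrightarrow> cfc f B (S x)"
    unfolding op_poly_intertwine[of S A B, OF S] by (intro tendsto_intros lim)
  ultimately show ?thesis by (rule LIMSEQ_unique)
qed

lemma bounded_image_rspec:
  fixes A :: "'a::{real_inner,banach} \<Rightarrow>\<^sub>L 'a"
  assumes A: "op_nonneg A" and f: "continuous_on {0..} f"
  shows "bounded (f ` rspec A)"
proof (rule bounded_subset)
  show "bounded (f ` {0..norm A})"
    by (intro compact_imp_bounded compact_continuous_image continuous_on_subset[OF f]) auto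
qed (use rspec_subset[OF A] in auto)

lemma cfc_nonneg:
  fixes A :: "'a::complex_hilbert \<Rightarrow>\<^sub>L 'a"
  assumes A: "op_nonneg A" and f: "continuous_on {0..} f" "\<And>t. t \<ge> 0 \<Longrightarrow> f t \<ge> 0"
  shows "op_nonneg (cfc f A)"
  unfolding op_nonneg_def
  using cfc_rel_selfadj[OF op_nonneg_selfadj[OF A] cfc_rel_cfc[OF A f(1)]]
    cfc_rel_inner_nonneg[OF op_nonneg_selfadj[OF A] cfc_rel_cfc[OF A f(1)]] f(2) rspec_subset[OF A]
  by (auto simp: subset_iff)

lemma cfc_mult:
  fixes A :: "'a::complex_hilbert \<Rightarrow>\<^sub>L 'a"
  assumes A: "op_nonneg A" and f: "continuous_on {0..} f" and g: "continuous_on {0..} g"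
  shows "cfc (\<lambda>t. f t * g t) A = cfc f A o\<^sub>L cfc g A"
  by (intro cfc_eqI cfc_rel_mult cfc_rel_cfc bounded_image_rspec op_nonneg_selfadj A f g)

lemma cfc_diff:
  fixes A :: "'a::complex_hilbert \<Rightarrow>\<^sub>L 'a"
  assumes A: "op_nonneg A" and f: "continuous_on {0..} f" and g: "continuous_on {0..} g"
  shows "cfc (\<lambda>t. f t - g t) A = cfc f A - cfc g A"
proof -
  have "cfc_rel (\<lambda>t. f t + (-1) * g t) A (cfc f A + (-1) *\<^sub>R cfc g A)"
    by (intro cfc_rel_add cfc_rel_scale cfc_rel_cfc A f g)
  then show ?thesis by (intro cfc_eqI op_nonneg_selfadj A) simp
qed

lemma cfc_mono:
  fixes A :: "'a::complex_hilbert \<Rightarrow>\<^sub>L 'a"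
  assumes A: "op_nonneg A" and f: "continuous_on {0..} f" and g: "continuous_on {0..} g"
    and le: "\<And>t. t \<ge> 0 \<Longrightarrow> f t \<le> g t"
  shows "inner (cfc f A x) x \<le> inner (cfc g A x) x"
proof -
  have "op_nonneg (cfc (\<lambda>t. g t - f t) A)"
    using le by (intro cfc_nonneg A continuous_on_diff f g) simp
  then show ?thesis
    by (simp add: cfc_diff[OF A g f] op_nonneg_def blinfun.diff_left inner_diff)
qed

text \<open>Self-adjointness of \<open>f(A)\<close> moves one factor across; comparing norms thereby
  reduces to comparing quadratic forms with \<open>cfc_mono\<close>.\<close>

lemma norm_cfc_power2:
  fixes A :: "'a::complex_hilbert \<Rightarrow>\<^sub>L 'a"
  assumes A: "op_nonneg A" and f: "continuous_on {0..} f"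
  shows "(norm (cfc f A x))\<^sup>2 = inner (cfc (\<lambda>t. (f t)\<^sup>2) A x) x"
  using selfadjD[OF cfc_rel_selfadj[OF op_nonneg_selfadj[OF A] cfc_rel_cfc[OF A f]], of "cfc f A x" x]
  by (simp add: power2_eq_square[of "f _"] cfc_mult[OF A f f] power2_norm_eq_inner)

lemma norm_cfc_mono:
  fixes A :: "'a::complex_hilbert \<Rightarrow>\<^sub>L 'a"
  assumes A: "op_nonneg A" and f: "continuous_on {0..} f" and g: "continuous_on {0..} g"
    and le: "\<And>t. t \<ge> 0 \<Longrightarrow> \<bar>f t\<bar> \<le> \<bar>g t\<bar>"
  shows "norm (cfc f A x) \<le> norm (cfc g A x)"
proof -
  have "(norm (cfc f A x))\<^sup>2 \<le> (norm (cfc g A x))\<^sup>2"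
    unfolding norm_cfc_power2[OF A f] norm_cfc_power2[OF A g]
    by (rule cfc_mono[OF A]) (auto intro!: continuous_intros f g simp: abs_le_square_iff[symmetric] le)
  then show ?thesis by (rule power2_le_imp_le) simp
qed

text \<open>Only values on the real spectrum matter, and it lies in \<open>{0..}\<close>. This hides
  the values of \<open>sqrt\<close> and similar functions at negative arguments.\<close>

lemma cfc_cong:
  fixes A :: "'a::complex_hilbert \<Rightarrow>\<^sub>L 'a"
  assumes A: "op_nonneg A" and f: "continuous_on {0..} f" and eq: "\<And>t. t \<ge> 0 \<Longrightarrow> f t = g t"
  shows "cfc f A = cfc g A"
proof -
  have "uniform_limit (rspec A) (\<lambda>n. poly (p n)) f sequentially
      \<longleftrightarrow> uniform_limit (rspec A) (\<lambda>n. poly (p n)) g sequentially" for p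
    using eq rspec_subset[OF A] by (intro uniform_limit_cong') (auto simp: subset_iff)
  then have "cfc_rel g A = cfc_rel f A" by (simp add: cfc_rel_def fun_eq_iff)
  then have "cfc g A = cfc f A"
    using cfc_rel_cfc[OF A f] by (intro cfc_eqI op_nonneg_selfadj A) simp
  then show ?thesis by simp
qed

lemma cfc_poly:
  fixes A :: "'a::complex_hilbert \<Rightarrow>\<^sub>L 'a"
  assumes A: "op_nonneg A"
  shows "cfc (poly p) A = op_poly p A"
  by (intro cfc_eqI op_nonneg_selfadj A cfc_rel_poly)

lemma cfc_ident:
  fixes A :: "'a::complex_hilbert \<Rightarrow>\<^sub>L 'a"
  assumes A: "op_nonneg A"
  shows "cfc (\<lambda>t. t) A = A"
proof -
  have "cfc (poly [:0, 1:]) A = A"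
    unfolding cfc_poly[OF A] by (rule blinfun_eqI) (simp add: op_poly_pCons_apply)
  moreover have "poly [:0, 1:] = (\<lambda>t::real. t)" by (simp add: fun_eq_iff)
  ultimately show ?thesis by metis
qed

section \<open>Convexity of powers and McCarthy's inequality\<close>

lemma powr_tangent_le:
  fixes s m r :: real
  assumes r: "r \<ge> 1" and "s \<ge> 0" "m > 0"
  shows "m powr r + r * m powr (r - 1) * (s - m) \<le> s powr r"
proof -
  define u where "u = s / m"
  have u: "u \<ge> 0" using assms by (simp add: u_def)
  \<comment> \<open>Bernoulli's inequality, read off from Young's inequality for the product
    \<open>u * 1\<close> with conjugate exponents \<open>r\<close> and \<open>q\<close>; it is then
    rescaled by \<open>m powr r\<close>.\<close>
  have "1 + r * (u - 1) \<le> u powr r"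
  proof (cases "u = 0 \<or> r = 1")
    case False
    define q where "q = r / (r - 1)"
    have "u * 1 \<le> u powr r / r + 1 powr q / q"
      using False r u by (intro Youngs_inequality) (auto simp: q_def field_simps)
    also have "1 powr q / q = (r - 1) / r" by (simp add: q_def)
    also have "u powr r / r + (r - 1) / r = (u powr r + (r - 1)) / r" by (simp add: add_divide_distrib)
    finally show ?thesis using r by (simp add: pos_le_divide_eq algebra_simps)
  qed (use r u in auto)
  then have "m powr r * (1 + r * (u - 1)) \<le> m powr r * u powr r"
    by (intro mult_left_mono) simp_all
  also have "m powr r * u powr r = s powr r"
    using assms by (simp add: u_def powr_divide)
  also have "m powr r * (1 + r * (u - 1)) = m powr r + r * m powr (r - 1) * (s - m)"
    using assms by (simp add: u_def powr_diff field_simps)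
  finally show ?thesis .
qed

text \<open>Jensen's inequality for the convex function \<open>s \<mapsto> s powr r\<close>, by integrating its tangent line at
  \<open>norm (A x) ^ 2\<close> against the spectral measure of \<open>x\<close>.\<close>

lemma mccarthy_le:
  fixes A :: "'a::complex_hilbert \<Rightarrow>\<^sub>L 'a"
  assumes A: "op_nonneg A" and r: "r \<ge> 1" and x: "norm x = 1"
  shows "norm (A x) powr (2 * r) \<le> inner (op_powr A (2 * r) x) x"
proof -
  define m where "m = (norm (A x))\<^sup>2"
  have cont: "continuous_on {0..} (\<lambda>t::real. t powr (2 * r))"
    using r by (intro continuous_on_powr' continuous_intros) auto
  show ?thesis
  proof (cases "m = 0")
    case True
    have "op_nonneg (op_powr A (2 * r))" unfolding op_powr_def by (rule cfc_nonneg[OF A cont]) simp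
    then show ?thesis using True by (simp add: m_def op_nonneg_def)
  next
    case False
    then have m: "m > 0" by (simp add: m_def)
    \<comment> \<open>The tangent of \<open>s powr r\<close> at \<open>s = m\<close>, taken at
      \<open>s = t\<^sup>2\<close> as a polynomial in \<open>t\<close>. Since
      \<open>inner (A (A x)) x = m\<close>, its linear part contributes nothing at the unit vector
      \<open>x\<close>.\<close>
    define p where "p = [:m powr r - r * m powr (r - 1) * m, 0, r * m powr (r - 1):]"
    have p: "poly p t = m powr r + r * m powr (r - 1) * (t\<^sup>2 - m)" for t
      by (simp add: p_def algebra_simps power2_eq_square)
    have "inner (cfc (poly p) A x) x \<le> inner (cfc (\<lambda>t. t powr (2 * r)) A x) x"
    proof (rule cfc_mono[OF A _ cont])
      fix t :: real assume "t \<ge> 0"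
      then have "t powr (2 * r) = (t\<^sup>2) powr r" by (cases "t = 0") (simp_all add: powr_powr flip: powr_numeral)
      then show "poly p t \<le> t powr (2 * r)"
        using powr_tangent_le[OF r _ m, of "t\<^sup>2"] by (simp add: p)
    qed (intro continuous_intros)
    moreover have "inner (A (A x)) x = m"
      using A by (simp add: m_def power2_norm_eq_inner op_nonneg_def selfadj_def)
    then have "inner (cfc (poly p) A x) x = m powr r"
      using x by (simp add: cfc_poly[OF A] p_def op_poly_pCons_apply inner_add
          dot_square_norm blinfun.scaleR_right blinfun.add_right)
    moreover have "m powr r = norm (A x) powr (2 * r)"
      using m by (simp add: m_def powr_powr flip: powr_numeral)
    ultimately show ?thesis by (simp add: op_powr_def)
  qed
qed

section \<open>Riesz representation and adjoints\<close>

text \<open>The representing vector minimises \<open>(norm x)\<^sup>2 - 2 * \<phi> x\<close>; the parallelogram law makes every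
  minimising sequence Cauchy.\<close>

lemma riesz_representation:
  fixes \<phi> :: "'a::{real_inner,banach} \<Rightarrow> real"
  assumes "bounded_linear \<phi>"
  obtains y where "\<And>x. \<phi> x = inner x y"
proof -
  interpret \<phi>: bounded_linear \<phi> by fact
  define J where "J x = (norm x)\<^sup>2 - 2 * \<phi> x" for x
  obtain K where K: "\<And>x. norm (\<phi> x) \<le> norm x * K" using \<phi>.bounded by blast
  have "- K\<^sup>2 \<le> J x" for x
  proof -
    have "\<phi> x \<le> norm x * K" using K[of x] by simp
    moreover have "0 \<le> (norm x - K)\<^sup>2" by simp
    ultimately show ?thesis by (simp add: J_def power2_diff)
  qed
  then have bdd: "bdd_below (range J)" by (rule bdd_belowI2)
  define d where "d = (INF x. J x)"
  have dJ: "d \<le> J x" for x unfolding d_def by (rule cINF_lower[OF bdd]) simp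
  have "\<exists>x. J x < d + inverse (real (Suc n))" for n
    using cINF_less_iff[OF _ bdd, of "d + inverse (real (Suc n))"] by (simp add: d_def)
  then obtain x where x: "\<And>n. J (x n) < d + inverse (real (Suc n))" by metis
  have par: "(norm (u - v))\<^sup>2 \<le> 2 * (J u - d) + 2 * (J v - d)" for u v
  proof -
    \<comment> \<open>The parallelogram law; the linear terms of \<open>J\<close> cancel.\<close>
    have "(norm (u - v))\<^sup>2 = 2 * J u + 2 * J v - 4 * J ((1/2) *\<^sub>R (u + v))"
      unfolding J_def power2_norm_eq_inner
      by (simp add: \<phi>.add \<phi>.scaleR inner_add inner_diff inner_commute algebra_simps)
    then show ?thesis using dJ[of "(1/2) *\<^sub>R (u + v)"] by simp
  qed
  have "Cauchy x"
  proof (rule CauchyI)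
    fix e :: real assume e: "e > 0"
    then have "e\<^sup>2 / 4 > 0" by simp
    from order_tendstoD(2)[OF LIMSEQ_inverse_real_of_nat this]
    obtain N where N: "\<And>n. n \<ge> N \<Longrightarrow> inverse (real (Suc n)) < e\<^sup>2 / 4"
      by (auto simp: eventually_sequentially)
    have "norm (x m - x n) < e" if "m \<ge> N" "n \<ge> N" for m n
    proof (rule power2_less_imp_less)
      show "(norm (x m - x n))\<^sup>2 < e\<^sup>2"
        using par[of "x m" "x n"] less_trans[OF x[of m] add_strict_left_mono[OF N[OF that(1)]]]
          less_trans[OF x[of n] add_strict_left_mono[OF N[OF that(2)]]]
        by (simp add: field_simps)
    qed (use e in simp)
    then show "\<exists>M. \<forall>m\<ge>M. \<forall>n\<ge>M. norm (x m - x n) < e" by blast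
  qed
  then obtain y where y: "x \<longlonglongrightarrow> y" by (auto simp: Cauchy_convergent_iff convergent_def)
  have "(\<lambda>n. J (x n)) \<longlonglongrightarrow> J y"
    unfolding J_def by (intro tendsto_intros y \<phi>.tendsto)
  moreover have "(\<lambda>n. d + inverse (real (Suc n))) \<longlonglongrightarrow> d + 0"
    by (intro tendsto_add tendsto_const LIMSEQ_inverse_real_of_nat)
  ultimately have "J y \<le> d + 0"
    by (rule LIMSEQ_le) (use x less_imp_le in blast)
  then have Jy: "J y \<le> J z" for z using dJ[of z] by simp
  have "\<phi> z = inner z y" for z
  proof -
    define c where "c = \<phi> z - inner z y"
    \<comment> \<open>The minimiser \<open>y\<close> is perturbed in the direction \<open>z\<close>.
      This step size turns minimality into \<open>2 * s * c \<le> s * c\<close>, which forces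
      \<open>c = 0\<close>; the \<open>+ 1\<close> avoids division by zero.\<close>
    define s where "s = c / ((norm z)\<^sup>2 + 1)"
    have n1: "(norm z)\<^sup>2 + 1 > 0" by (simp add: add_nonneg_pos)
    have "J (y + s *\<^sub>R z) = J y + s\<^sup>2 * (norm z)\<^sup>2 - 2 * s * c"
      unfolding J_def c_def power2_norm_eq_inner
      by (simp add: \<phi>.add \<phi>.scaleR inner_add inner_commute power2_eq_square algebra_simps)
    then have "2 * s * c \<le> s\<^sup>2 * (norm z)\<^sup>2" using Jy[of "y + s *\<^sub>R z"] by simp
    also have "\<dots> \<le> s\<^sup>2 * ((norm z)\<^sup>2 + 1)" by (simp add: mult_left_mono)
    also have "\<dots> = s * c" using n1 by (simp add: s_def power2_eq_square)
    finally have "s * c \<le> 0" by (simp add: mult.commute)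
    then have "c\<^sup>2 / ((norm z)\<^sup>2 + 1) \<le> 0" by (simp add: s_def power2_eq_square)
    then have "c\<^sup>2 \<le> 0" using n1 by (simp add: divide_le_0_iff)
    then show ?thesis by (simp add: c_def)
  qed
  then show thesis by (rule that)
qed

text \<open>Riesz representation of \<open>x \<mapsto> inner (A x) y\<close> for each
  \<open>y\<close>; linearity in \<open>y\<close> follows since representing vectors are
  unique.\<close>

lemma real_adjoint_exists:
  fixes A :: "'a::{real_inner,banach} \<Rightarrow>\<^sub>L 'b::real_inner"
  obtains B :: "'b \<Rightarrow>\<^sub>L 'a" where "\<And>x y. inner (A x) y = inner x (B y)"
proof -
  have "\<exists>z. \<forall>x. inner (A x) y = inner x z" for y
    by (rule riesz_representation[of "\<lambda>x. inner (A x) y"])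
      (auto intro!: bounded_linear_inner_left_comp blinfun.bounded_linear_right)
  then obtain B where B: "\<And>x y. inner (A x) y = inner x (B y)" by metis
  have eqI: "u = v" if "\<And>x. inner x u = inner x v" for u v :: 'a
    using that[of "u - v"] by (metis eq_iff_diff_eq_0 inner_diff_right inner_eq_zero_iff)
  have "bounded_linear B"
  proof (rule bounded_linear_intro[where K = "norm A"])
    show "B (x + y) = B x + B y" for x y by (rule eqI) (simp add: inner_add_right flip: B)
    show "B (r *\<^sub>R x) = r *\<^sub>R B x" for r x by (rule eqI) (simp flip: B)
    show "norm (B y) \<le> norm y * norm A" for y
    proof (cases "B y = 0")
      case False
      have "norm (B y) * norm (B y) = inner (A (B y)) y" by (simp add: B flip: power2_norm_eq_inner power2_eq_square)
      also have "\<dots> \<le> norm A * norm (B y) * norm y"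
        using norm_cauchy_schwarz[of "A (B y)" y] mult_right_mono[OF norm_blinfun[of A "B y"] norm_ge_zero[of y]]
        by linarith
      finally show ?thesis using False by (simp add: mult_ac)
    qed simp
  qed
  then show thesis using that[of "Blinfun B"] B by (simp add: bounded_linear_Blinfun_apply)
qed

section \<open>Complex structure and the complex adjoint\<close>

lemma cinner_scaleC_right: "cinner x (c *\<^sub>C y) = cnj c * cinner x y"
  by (subst (1 2) cinner_commute) (simp add: cinner_scaleC_left)

text \<open>With \<open>inner_eq_Re_cinner\<close> this recovers \<open>cinner\<close> from the real
  inner product.\<close>

lemma Im_cinner: "Im (cinner x y) = - inner (\<i> *\<^sub>C x) y"
  by (simp add: inner_eq_Re_cinner cinner_scaleC_left)

lemma cinner_right_eqI:
  assumes "\<And>x. cinner x u = cinner x v"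
  shows "u = v"
proof -
  have "inner (u - v) u = inner (u - v) v" using assms[of "u - v"] by (simp add: inner_eq_Re_cinner)
  then show ?thesis by (metis eq_iff_diff_eq_0 inner_diff_right inner_eq_zero_iff)
qed

lemma complex_linearD:
  assumes "complex_linear A"
  shows "A (c *\<^sub>C x) = c *\<^sub>C A x"
  using assms by (simp add: complex_linear_def)

text \<open>The real adjoint is also the complex one: real parts agree at once, imaginary parts
  after replacing \<open>x\<close> by \<open>\<i> *\<^sub>C x\<close>. Uniqueness then resolves the
  description in \<open>adj\<close>.\<close>

lemma cinner_adj:
  fixes A :: "'a::complex_hilbert \<Rightarrow>\<^sub>L 'b::complex_hilbert"
  assumes A: "complex_linear A"
  shows "cinner (A x) y = cinner x (adj A y)"
proof -
  obtain B :: "'b \<Rightarrow>\<^sub>L 'a" where B: "\<And>x y. inner (A x) y = inner x (B y)"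
    using real_adjoint_exists[of A] by blast
  have "cinner (A x) y = cinner x (B y)" for x y
    by (simp add: complex_eq_iff Im_cinner B flip: inner_eq_Re_cinner complex_linearD[OF A])
  moreover have "C = B" if "\<forall>x y. cinner (A x) y = cinner x (C y)" for C :: "'b \<Rightarrow>\<^sub>L 'a"
    by (rule blinfun_eqI, rule cinner_right_eqI)
      (simp add: that[rule_format, symmetric] calculation[symmetric])
  ultimately have "\<exists>!B :: 'b \<Rightarrow>\<^sub>L 'a. \<forall>x y. cinner (A x) y = cinner x (B y)" by blast
  from theI'[OF this] show ?thesis unfolding adj_def by blast
qed

lemma inner_adj:
  fixes A :: "'a::complex_hilbert \<Rightarrow>\<^sub>L 'b::complex_hilbert"
  shows "complex_linear A \<Longrightarrow> inner (A x) y = inner x (adj A y)"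
  by (simp add: inner_eq_Re_cinner cinner_adj)

lemma inner_adj_left:
  fixes A :: "'a::complex_hilbert \<Rightarrow>\<^sub>L 'b::complex_hilbert"
  shows "complex_linear A \<Longrightarrow> inner (adj A y) x = inner y (A x)"
  by (metis inner_adj inner_commute)

lemma complex_linear_adj:
  fixes A :: "'a::complex_hilbert \<Rightarrow>\<^sub>L 'b::complex_hilbert"
  assumes A: "complex_linear A"
  shows "complex_linear (adj A)"
  unfolding complex_linear_def
proof (intro conjI allI)
  show "adj A (c *\<^sub>C y) = c *\<^sub>C adj A y" for c y
    by (rule cinner_right_eqI) (simp add: cinner_scaleC_right flip: cinner_adj[OF A])
qed (rule blinfun.add_right)

lemma adj_adj:
  fixes A :: "'a::complex_hilbert \<Rightarrow>\<^sub>L 'b::complex_hilbert"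
  assumes A: "complex_linear A"
  shows "adj (adj A) = A"
proof (rule blinfun_eqI, rule cinner_right_eqI)
  fix x y
  have "cinner y (adj (adj A) x) = cnj (cinner x (adj A y))"
    unfolding cinner_adj[OF complex_linear_adj[OF A], symmetric] by (rule cinner_commute)
  also have "\<dots> = cinner y (A x)"
    unfolding cinner_adj[OF A, symmetric] by (rule cinner_commute[symmetric])
  finally show "cinner y (adj (adj A) x) = cinner y (A x)" .
qed

lemma norm_scaleC: "norm (c *\<^sub>C x) = cmod c * norm (x::'a::complex_inner)"
proof -
  have "inner (c *\<^sub>C x) (c *\<^sub>C x) = (cmod c)\<^sup>2 * inner x x"
  proof -
    have "cinner (c *\<^sub>C x) (c *\<^sub>C x) = of_real ((cmod c)\<^sup>2) * cinner x x"
      by (simp add: cinner_scaleC_left cinner_scaleC_right complex_norm_square mult.commute del: of_real_power)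
    then show ?thesis by (simp add: inner_eq_Re_cinner)
  qed
  then show ?thesis by (simp add: norm_eq_sqrt_inner real_sqrt_mult)
qed

text \<open>Rotating \<open>y\<close> by a unimodular scalar lets bounds on the real inner product
  control the modulus of the complex one.\<close>

lemma exists_phase:
  fixes x y :: "'a::complex_inner"
  obtains w where "cmod w = 1" "inner x (w *\<^sub>C y) = cmod (cinner x y)"
proof (cases "cinner x y = 0")
  case True
  then show thesis using that[of 1] by (simp add: inner_eq_Re_cinner scaleC_one)
next
  case False
  define z where "z = cinner x y"
  have "cnj (sgn z) * z = cmod z"
    using False by (simp add: z_def sgn_eq complex_norm_square[symmetric] power2_eq_square mult.commute)
  then show thesis
    using False by (intro that[of "sgn z"])
      (simp_all add: inner_eq_Re_cinner cinner_scaleC_right z_def norm_sgn)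
qed

lemma cmod_cinner_le: "cmod (cinner x y) \<le> norm x * norm (y::'a::complex_inner)"
proof -
  obtain w where "cmod w = 1" "inner x (w *\<^sub>C y) = cmod (cinner x y)"
    by (rule exists_phase)
  then show ?thesis using norm_cauchy_schwarz[of x "w *\<^sub>C y"] by (simp add: norm_scaleC)
qed

text \<open>Multiplication by \<open>c\<close> is a bounded real linear operator commuting with
  \<open>A\<close>, so it commutes with \<open>f(A)\<close> by
  \<open>cfc_intertwine\<close>.\<close>

lemma complex_linear_cfc:
  fixes A :: "'a::complex_hilbert \<Rightarrow>\<^sub>L 'a"
  assumes A: "op_nonneg A" "complex_linear A" and f: "continuous_on {0..} f"
  shows "complex_linear (cfc f A)"
  unfolding complex_linear_def
proof (intro conjI allI)
  fix c :: complex and x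
  have "bounded_linear ((*\<^sub>C) c :: 'a \<Rightarrow> 'a)"
    by (rule bounded_linear_intro[where K = "cmod c"])
      (simp_all add: scaleC_add_right scaleR_eq_scaleC scaleC_scaleC norm_scaleC mult.commute)
  then have W: "Blinfun ((*\<^sub>C) c) x = c *\<^sub>C x" for x :: 'a
    by (simp add: bounded_linear_Blinfun_apply)
  show "cfc f A (c *\<^sub>C x) = c *\<^sub>C cfc f A x"
    using cfc_intertwine[OF A(1) A(1) f, of "Blinfun ((*\<^sub>C) c)" x] by (simp add: W complex_linearD[OF A(2)])
qed (rule blinfun.add_right)

section \<open>Absolute value and mixed Schwarz inequality\<close>

lemma op_nonneg_adj_compose:
  fixes A :: "'a::complex_hilbert \<Rightarrow>\<^sub>L 'b::complex_hilbert"
  assumes A: "complex_linear A"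
  shows "op_nonneg (adj A o\<^sub>L A)"
  unfolding op_nonneg_def selfadj_def
  by (simp add: inner_adj_left[OF A] flip: inner_adj[OF A])

lemma op_nonneg_op_abs:
  fixes A :: "'a::complex_hilbert \<Rightarrow>\<^sub>L 'b::complex_hilbert"
  assumes A: "complex_linear A"
  shows "op_nonneg (op_abs A)"
  unfolding op_abs_def
  by (rule cfc_nonneg[OF op_nonneg_adj_compose[OF A]]) (auto intro!: continuous_intros)

lemma complex_linear_op_abs:
  fixes A :: "'a::complex_hilbert \<Rightarrow>\<^sub>L 'b::complex_hilbert"
  assumes A: "complex_linear A"
  shows "complex_linear (op_abs A)"
  unfolding op_abs_def
proof (rule complex_linear_cfc[OF op_nonneg_adj_compose[OF A]])
  show "complex_linear (adj A o\<^sub>L A)"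
    using A complex_linear_adj[OF A] by (simp add: complex_linear_def)
qed (auto intro!: continuous_intros)

lemma norm_op_abs:
  fixes A :: "'a::complex_hilbert \<Rightarrow>\<^sub>L 'b::complex_hilbert"
  assumes A: "complex_linear A"
  shows "norm (op_abs A x) = norm (A x)"
proof -
  note nn = op_nonneg_adj_compose[OF A]
  have sq: "continuous_on {0..} sqrt" by (auto intro!: continuous_intros)
  have "cfc (\<lambda>t. (sqrt t)\<^sup>2) (adj A o\<^sub>L A) = cfc (\<lambda>t. t) (adj A o\<^sub>L A)"
    by (rule cfc_cong[OF nn]) (auto intro!: continuous_intros)
  then have "(norm (op_abs A x))\<^sup>2 = inner (adj A (A x)) x"
    unfolding op_abs_def norm_cfc_power2[OF nn sq] by (simp add: cfc_ident[OF nn])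
  also have "\<dots> = (norm (A x))\<^sup>2"
    by (simp add: power2_norm_eq_inner inner_adj_left[OF A])
  finally show ?thesis by simp
qed

lemma op_abs_intertwine:
  fixes A :: "'a::complex_hilbert \<Rightarrow>\<^sub>L 'b::complex_hilbert"
  assumes A: "complex_linear A"
  shows "A (op_abs A x) = op_abs (adj A) (A x)"
  unfolding op_abs_def adj_adj[OF A]
proof (rule cfc_intertwine[OF op_nonneg_adj_compose[OF A]])
  show "op_nonneg (A o\<^sub>L adj A)"
    using op_nonneg_adj_compose[OF complex_linear_adj[OF A]] by (simp add: adj_adj[OF A])
qed (auto intro!: continuous_intros)

text \<open>With \<open>P = |A|\<close> and \<open>Q = |A*|\<close> one has \<open>A g(P) = g(Q) A\<close>. The vector \<open>x\<close> is replaced by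
  \<open>g(P) k(P) x\<close> with \<open>k = g / (g\<^sup>2 + d\<^sup>2)\<close>, which approximates it up to what \<open>A\<close> nearly kills; this
  avoids the polar decomposition.\<close>

lemma mixed_schwarz_inner:
  fixes A :: "'a::complex_hilbert \<Rightarrow>\<^sub>L 'b::complex_hilbert"
  assumes A: "complex_linear A"
    and f: "continuous_on {0..} f" "\<And>t. t \<ge> 0 \<Longrightarrow> f t \<ge> 0"
    and g: "continuous_on {0..} g" "\<And>t. t \<ge> 0 \<Longrightarrow> g t \<ge> 0"
    and fg: "\<And>t. t \<ge> 0 \<Longrightarrow> f t * g t = t"
  shows "inner (A x) y \<le> norm (cfc f (op_abs A) x) * norm (cfc g (op_abs (adj A)) y)"
proof -
  define P where "P = op_abs A"
  define Q where "Q = op_abs (adj A)"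
  have P: "op_nonneg P" and Q: "op_nonneg Q"
    unfolding P_def Q_def by (intro op_nonneg_op_abs complex_linear_adj A)+
  define a where "a = norm (cfc f P x)"
  define b where "b = norm (cfc g Q y)"
  have id: "continuous_on {0..} (\<lambda>t::real. t)" by (intro continuous_intros)
  have approx: "inner (A x) y \<le> a * b + d * (a * norm y)" if d: "d > 0" for d
  proof -
    define k where "k t = g t / ((g t)\<^sup>2 + d\<^sup>2)" for t
    have pos: "(g t)\<^sup>2 + d\<^sup>2 > 0" for t using d by (simp add: add_nonneg_pos)
    then have nz: "(g t)\<^sup>2 + d\<^sup>2 \<noteq> 0" for t by (metis less_irrefl)
    have k: "continuous_on {0..} k"
      unfolding k_def by (intro continuous_intros g) (use nz in blast)
    define z where "z = cfc k P x"
    define v where "v = cfc g P z"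
    have "inner (A v) y = inner (A z) (cfc g Q y)"
    proof -
      have "A v = cfc g Q (A z)"
        unfolding v_def
        by (rule cfc_intertwine[OF P Q g(1)]) (simp add: P_def Q_def op_abs_intertwine[OF A])
      then show ?thesis
        using cfc_nonneg[OF Q g(1,2)] by (simp add: op_nonneg_def selfadj_def)
    qed
    also have "\<dots> \<le> norm (A z) * b"
      unfolding b_def by (rule norm_cauchy_schwarz)
    also have "\<dots> \<le> a * b"
    proof (rule mult_right_mono)
      have "norm (A z) = norm (P z)" by (simp add: P_def norm_op_abs[OF A])
      also have "P z = cfc (\<lambda>t. t * k t) P x"
        by (simp add: z_def cfc_mult[OF P id k] cfc_ident[OF P])
      \<comment> \<open>As \<open>t = f t * g t\<close>, the function \<open>t * k t\<close> is
        \<open>f t\<close> times a factor in \<open>{0..1}\<close>.\<close>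
      also have "norm \<dots> \<le> a"
        unfolding a_def
      proof (rule norm_cfc_mono[OF P])
        fix t :: real assume t: "t \<ge> 0"
        have "t * k t = f t * ((g t)\<^sup>2 / ((g t)\<^sup>2 + d\<^sup>2))"
          using fg[OF t] by (simp add: k_def power2_eq_square flip: mult.assoc)
        moreover have "(g t)\<^sup>2 / ((g t)\<^sup>2 + d\<^sup>2) \<le> 1" using pos[of t] by simp
        moreover have "0 \<le> (g t)\<^sup>2 / ((g t)\<^sup>2 + d\<^sup>2)" by simp
        ultimately show "\<bar>t * k t\<bar> \<le> \<bar>f t\<bar>"
          using f(2)[OF t] by (simp only: abs_mult abs_of_nonneg mult_left_le)
      qed (intro continuous_intros k f)+
      finally show "norm (A z) \<le> a" .
    qed (simp add: b_def)
    finally have 1: "inner (A v) y \<le> a * b" .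
    have "norm (A (x - v)) \<le> d * a"
    proof -
      have gk: "continuous_on {0..} (\<lambda>t. g t * k t)" by (intro continuous_intros k g)
      have "norm (A (x - v)) = norm (P (x - v))" by (simp add: P_def norm_op_abs[OF A])
      also have "P (x - v) = P x - cfc (\<lambda>t. t * (g t * k t)) P x"
        by (simp add: v_def z_def cfc_mult[OF P id gk] cfc_mult[OF P g(1) k] cfc_ident[OF P] blinfun.diff_right)
      also have "\<dots> = cfc (\<lambda>t. t - t * (g t * k t)) P x"
        by (subst cfc_diff[OF P id])
          (auto intro!: continuous_intros gk simp: cfc_ident[OF P] blinfun.diff_left)
      \<comment> \<open>The function equals \<open>d * f t\<close> times
        \<open>g t * d / ((g t)\<^sup>2 + d\<^sup>2)\<close>, a factor in \<open>{0..1}\<close>;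
        hence the error is of order \<open>d\<close>.\<close>
      also have "norm \<dots> \<le> norm (cfc (\<lambda>t. d * f t) P x)"
      proof (rule norm_cfc_mono[OF P])
        fix t :: real assume t: "t \<ge> 0"
        have "t - t * (g t * k t) = t * (1 - g t * k t)" by (simp add: right_diff_distrib)
        also have "1 - g t * k t = d\<^sup>2 / ((g t)\<^sup>2 + d\<^sup>2)"
          using nz[of t] by (simp add: k_def power2_eq_square field_simps)
        also have "t * \<dots> = f t * g t * (d\<^sup>2 / ((g t)\<^sup>2 + d\<^sup>2))"
          by (simp only: fg[OF t])
        also have "\<dots> = f t * d * (g t * d / ((g t)\<^sup>2 + d\<^sup>2))"
          by (simp add: power2_eq_square)
        finally have "t - t * (g t * k t) = f t * d * (g t * d / ((g t)\<^sup>2 + d\<^sup>2))" .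
        moreover have "g t * d / ((g t)\<^sup>2 + d\<^sup>2) \<le> 1"
        proof -
          have "0 \<le> (g t - d)\<^sup>2" by simp
          then have "2 * (g t * d) \<le> (g t)\<^sup>2 + d\<^sup>2" by (simp add: power2_diff)
          moreover have "0 \<le> g t * d" using g(2)[OF t] d by simp
          ultimately have "g t * d \<le> (g t)\<^sup>2 + d\<^sup>2" by linarith
          then show ?thesis using pos[of t] by simp
        qed
        moreover have "0 \<le> g t * d / ((g t)\<^sup>2 + d\<^sup>2)" using g(2)[OF t] d by simp
        moreover have "0 \<le> f t * d" using f(2)[OF t] d by simp
        ultimately show "\<bar>t - t * (g t * k t)\<bar> \<le> \<bar>d * f t\<bar>"
          by (metis abs_of_nonneg mult.commute mult_left_le mult_nonneg_nonneg)
      qed (intro continuous_intros gk f)+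
      also have "cfc (\<lambda>t. d * f t) P = d *\<^sub>R cfc f P"
        by (intro cfc_eqI cfc_rel_scale cfc_rel_cfc op_nonneg_selfadj P f)
      finally show ?thesis using d by (simp add: a_def blinfun.scaleR_left)
    qed
    then have "inner (A (x - v)) y \<le> d * a * norm y"
      using norm_cauchy_schwarz[of "A (x - v)" y] mult_right_mono[OF _ norm_ge_zero[of y]]
      by (meson order_trans)
    moreover have "inner (A x) y = inner (A v) y + inner (A (x - v)) y"
      by (simp add: blinfun.diff_right inner_diff)
    ultimately show ?thesis using 1 by (simp add: mult.assoc)
  qed
  have "((\<lambda>d. a * b + d * (a * norm y)) \<longlongrightarrow> a * b + 0 * (a * norm y)) (at_right 0)"
    by (intro tendsto_intros)
  then have "inner (A x) y \<le> a * b + 0 * (a * norm y)"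
    by (rule tendsto_lowerbound) (auto simp: eventually_at_right_less approx intro: eventually_mono[OF eventually_at_right_less])
  then show ?thesis by (simp add: a_def b_def P_def Q_def)
qed

text \<open>Apply the real version to a rotated \<open>y\<close>; \<open>g(|A*|)\<close> is complex
  linear, so the rotation does not change the norm on the right.\<close>

lemma mixed_schwarz:
  fixes A :: "'a::complex_hilbert \<Rightarrow>\<^sub>L 'b::complex_hilbert"
  assumes A: "complex_linear A"
    and f: "continuous_on {0..} f" "\<And>t. t \<ge> 0 \<Longrightarrow> f t \<ge> 0"
    and g: "continuous_on {0..} g" "\<And>t. t \<ge> 0 \<Longrightarrow> g t \<ge> 0"
    and fg: "\<And>t. t \<ge> 0 \<Longrightarrow> f t * g t = t"
  shows "cmod (cinner (A x) y) \<le> norm (cfc f (op_abs A) x) * norm (cfc g (op_abs (adj A)) y)"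
proof -
  obtain w where w: "cmod w = 1" "inner (A x) (w *\<^sub>C y) = cmod (cinner (A x) y)"
    by (rule exists_phase)
  have "complex_linear (cfc g (op_abs (adj A)))"
    by (intro complex_linear_cfc op_nonneg_op_abs complex_linear_op_abs complex_linear_adj A g(1))
  then show ?thesis
    using mixed_schwarz_inner[OF A f g fg, of x "w *\<^sub>C y"]
    by (simp add: w complex_linearD norm_scaleC)
qed

section \<open>Berezin number of an off-diagonal block operator\<close>

lemma cmod_berezin_symbol_le: "cmod (berezin_symbol k A l) \<le> norm A"
proof -
  define u where "u = k l /\<^sub>R norm (k l)"
  \<comment> \<open>If \<open>k l = 0\<close>, then \<open>u = 0\<close>; in general only this
    inequality holds.\<close>
  have u: "norm u \<le> 1" by (cases "k l = 0") (simp_all add: u_def)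
  have "cmod (cinner (A u) u) \<le> norm (A u) * norm u" by (rule cmod_cinner_le)
  also have "\<dots> \<le> norm (A u) * 1" using u by (intro mult_left_mono) auto
  also have "\<dots> \<le> norm A * norm u" by (simp add: norm_blinfun)
  also have "\<dots> \<le> norm A * 1" using u by (intro mult_left_mono) auto
  finally show ?thesis by (simp add: berezin_symbol_def u_def Let_def)
qed

lemma berezin_symbol_le_ber:
  assumes "l \<in> \<Omega>"
  shows "cmod (berezin_symbol k A l) \<le> ber \<Omega> k A"
  unfolding ber_def using assms
  by (intro cSUP_upper bdd_aboveI2[where M = "norm A"] cmod_berezin_symbol_le)

lemma ber_nonneg: "\<Omega> \<noteq> {} \<Longrightarrow> 0 \<le> ber \<Omega> k A"
  by (meson ex_in_conv norm_ge_zero berezin_symbol_le_ber order_trans)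

text \<open>Taking \<open>r\<close>-th roots turns the pointwise bound into one for the supremum,
  which is then raised back to the power \<open>r\<close>.\<close>

lemma ber_powr_le:
  assumes "\<Omega> \<noteq> {}" "r > 0" "\<And>l. l \<in> \<Omega> \<Longrightarrow> cmod (berezin_symbol k A l) powr r \<le> R"
  shows "ber \<Omega> k A powr r \<le> R"
proof -
  obtain l where l: "l \<in> \<Omega>" using assms(1) by blast
  have R: "0 \<le> R" using order_trans[OF powr_ge_zero assms(3)[OF l]] .
  have "ber \<Omega> k A \<le> R powr (1 / r)"
    unfolding ber_def
  proof (rule cSUP_least[OF assms(1)])
    fix l assume "l \<in> \<Omega>"
    from powr_mono2[OF _ _ assms(3)[OF this], of "1 / r"] assms(2)
    show "cmod (berezin_symbol k A l) \<le> R powr (1 / r)" by (simp add: powr_powr)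
  qed
  then have "ber \<Omega> k A powr r \<le> (R powr (1 / r)) powr r"
    using assms(1,2) by (intro powr_mono2 ber_nonneg) auto
  then show ?thesis using assms(2) R by (simp add: powr_powr)
qed

section \<open>The estimate at a pair of kernels\<close>

lemma powr_mean_le:
  fixes p q r :: real
  assumes "r \<ge> 1" "p \<ge> 0" "q \<ge> 0"
  shows "((p + q) / 2) powr r \<le> (p powr r + q powr r) / 2"
proof (cases "p + q = 0")
  case False
  define m where "m = (p + q) / 2"
  have m: "m > 0" using False assms by (simp add: m_def)
  \<comment> \<open>Both powers lie above the tangent at the midpoint \<open>m\<close>; its linear
    terms cancel in the sum.\<close>
  have "(p - m) + (q - m) = 0" by (simp add: m_def)
  then have "c * (p - m) + c * (q - m) = 0" for c
    unfolding distrib_left[symmetric] by simp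
  then have "2 * m powr r \<le> p powr r + q powr r"
    using add_mono[OF powr_tangent_le[OF assms(1,2) m] powr_tangent_le[OF assms(1,3) m]]
    by (simp add: add.assoc add.left_commute)
  then show ?thesis by (simp add: m_def)
next
  case True
  then have "p = 0" "q = 0" using assms by auto
  then show ?thesis by simp
qed

text \<open>McCarthy's inequality is applied to both operators at the same normalised kernel; the
  resulting quadratic form is the real part of a Berezin symbol.\<close>

lemma norm_powr_sum_le_ber:
  fixes A B :: "'h::complex_hilbert \<Rightarrow>\<^sub>L 'h"
  assumes "op_nonneg A" "op_nonneg B" "r \<ge> 1" "l \<in> \<Omega>" "k l \<noteq> 0"
  shows "norm (A (k l /\<^sub>R norm (k l))) powr (2 * r) + norm (B (k l /\<^sub>R norm (k l))) powr (2 * r)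
    \<le> ber \<Omega> k (op_powr A (2 * r) + op_powr B (2 * r))"
proof -
  define u where "u = k l /\<^sub>R norm (k l)"
  have u: "norm u = 1" using assms by (simp add: u_def)
  define C where "C = op_powr A (2 * r) + op_powr B (2 * r)"
  have "norm (A u) powr (2 * r) + norm (B u) powr (2 * r) \<le> inner (C u) u"
    using mccarthy_le[OF assms(1,3) u] mccarthy_le[OF assms(2,3) u]
    by (simp add: C_def blinfun.add_left inner_add)
  also have "\<dots> \<le> cmod (cinner (C u) u)"
    by (simp add: inner_eq_Re_cinner complex_Re_le_cmod)
  also have "\<dots> = cmod (berezin_symbol k C l)" by (simp add: berezin_symbol_def u_def Let_def)
  also have "\<dots> \<le> ber \<Omega> k C" by (rule berezin_symbol_le_ber) fact
  finally show ?thesis by (simp add: u_def C_def)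
qed

text \<open>Common form of both inequalities: the only information used about \<open>X\<close> and
  \<open>Y\<close> is a mixed Schwarz bound for each, with \<open>A\<close>, \<open>B\<close> acting
  on the second space and \<open>C\<close>, \<open>D\<close> on the first.\<close>

lemma ber_off_diagonal_le:
  fixes X :: "'h2::complex_hilbert \<Rightarrow>\<^sub>L 'h1::complex_hilbert" and Y :: "'h1 \<Rightarrow>\<^sub>L 'h2"
    and A B :: "'h2 \<Rightarrow>\<^sub>L 'h2" and C D :: "'h1 \<Rightarrow>\<^sub>L 'h1"
  assumes ne: "\<Omega>1 \<noteq> {}" "\<Omega>2 \<noteq> {}"
    and k: "\<And>l. l \<in> \<Omega>1 \<Longrightarrow> k1 l \<noteq> 0" "\<And>l. l \<in> \<Omega>2 \<Longrightarrow> k2 l \<noteq> 0"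
    and r: "r \<ge> 1"
    and nonneg: "op_nonneg A" "op_nonneg B" "op_nonneg C" "op_nonneg D"
    and X: "\<And>x y. cmod (cinner (X x) y) \<le> norm (A x) * norm (D y)"
    and Y: "\<And>x y. cmod (cinner (Y x) y) \<le> norm (C x) * norm (B y)"
  shows "ber (\<Omega>1 \<times> \<Omega>2) (sum_kernel k1 k2) (block_op 0 X Y 0) powr r
    \<le> 2 powr r / 2 * ber \<Omega>2 k2 (op_powr A (2 * r) + op_powr B (2 * r)) powr (1/2)
      * ber \<Omega>1 k1 (op_powr C (2 * r) + op_powr D (2 * r)) powr (1/2)"
proof (rule ber_powr_le)
  fix l assume "l \<in> \<Omega>1 \<times> \<Omega>2"
  then obtain l1 l2 where l: "l = (l1, l2)" "l1 \<in> \<Omega>1" "l2 \<in> \<Omega>2" by blast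
  define n1 n2 N where "n1 = norm (k1 l1)" and "n2 = norm (k2 l2)" and "N = norm (k1 l1, k2 l2)"
  have n: "n1 > 0" "n2 > 0" using k l by (auto simp: n1_def n2_def)
  have N2: "N\<^sup>2 = n1\<^sup>2 + n2\<^sup>2" by (simp add: N_def n1_def n2_def norm_Pair)
  have N: "N > 0" using n by (simp add: N_def n1_def zero_prod_def)
  define u1 where "u1 = k1 l1 /\<^sub>R n1"
  define u2 where "u2 = k2 l2 /\<^sub>R n2"
  define v1 where "v1 = (n1 / N) *\<^sub>R u1"
  define v2 where "v2 = (n2 / N) *\<^sub>R u2"
  define a b c d where "a = norm (A u2)" and "b = norm (B u2)" and "c = norm (C u1)" and "d = norm (D u1)"
  have abcd: "0 \<le> a" "0 \<le> b" "0 \<le> c" "0 \<le> d" by (simp_all add: a_def b_def c_def d_def)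
  define s where "s = cmod (berezin_symbol (sum_kernel k1 k2) (block_op 0 X Y 0) l)"
  have "s \<le> (a * d + c * b) / 2"
  proof -
    have "sum_kernel k1 k2 l /\<^sub>R norm (sum_kernel k1 k2 l) = (v1, v2)"
      using n by (simp add: sum_kernel_def l v1_def v2_def u1_def u2_def scaleR_prod_def N_def inverse_eq_divide)
    then have "s = cmod (cinner (X v2) v1 + cinner (Y v1) v2)"
      by (simp add: s_def berezin_symbol_def cinner_prod_def)
    also have "\<dots> \<le> norm (A v2) * norm (D v1) + norm (C v1) * norm (B v2)"
      by (rule order_trans[OF norm_triangle_ineq add_mono[OF X Y]])
    also have "\<dots> = n1 * n2 / N\<^sup>2 * (a * d + c * b)"
      using n N by (simp add: v1_def v2_def blinfun.scaleR_right a_def b_def c_def d_def power2_eq_square field_simps)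
    also have "\<dots> \<le> 1 / 2 * (a * d + c * b)"
    proof (rule mult_right_mono)
      \<comment> \<open>The arithmetic-geometric mean inequality bounds the product of the weights
        \<open>n1 / N\<close> and \<open>n2 / N\<close>, whose squares sum to 1.\<close>
      have "0 \<le> (n1 - n2)\<^sup>2" by simp
      then have "2 * (n1 * n2) \<le> N\<^sup>2" by (simp add: N2 power2_diff)
      then show "n1 * n2 / N\<^sup>2 \<le> 1 / 2" using N by (simp add: divide_le_eq)
    qed (use abcd in simp)
    finally show ?thesis by simp
  qed
  moreover have "0 \<le> s" by (simp add: s_def)
  ultimately have "s powr r \<le> ((a * d + c * b) / 2) powr r" using r by (intro powr_mono2) auto
  also have "\<dots> \<le> ((a * d) powr r + (c * b) powr r) / 2"
    using r abcd by (intro powr_mean_le) auto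
  also have "\<dots> = 1 / 2 * (a powr r * d powr r + b powr r * c powr r)"
    using abcd by (simp add: powr_mult)
  \<comment> \<open>Cauchy--Schwarz for the plane vectors \<open>(a powr r, b powr r)\<close> and
    \<open>(d powr r, c powr r)\<close>. This pairing separates the quantities of the two
    spaces.\<close>
  also have "\<dots> \<le> 1 / 2 * sqrt ((a powr (2 * r) + b powr (2 * r)) * (c powr (2 * r) + d powr (2 * r)))"
  proof (intro mult_left_mono real_le_rsqrt)
    have "0 \<le> (a powr r * c powr r - b powr r * d powr r)\<^sup>2" by simp
    moreover have "t powr (2 * r) = (t powr r)\<^sup>2" for t :: real
      by (simp add: power2_eq_square flip: powr_add)
    ultimately show "(a powr r * d powr r + b powr r * c powr r)\<^sup>2
        \<le> (a powr (2 * r) + b powr (2 * r)) * (c powr (2 * r) + d powr (2 * r))"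
      by (simp add: power2_eq_square algebra_simps)
  qed simp
  also have "\<dots> \<le> 2 powr r / 2 * sqrt (ber \<Omega>2 k2 (op_powr A (2 * r) + op_powr B (2 * r))
      * ber \<Omega>1 k1 (op_powr C (2 * r) + op_powr D (2 * r)))"
  proof (intro mult_mono real_sqrt_le_mono)
    show "a powr (2 * r) + b powr (2 * r) \<le> ber \<Omega>2 k2 (op_powr A (2 * r) + op_powr B (2 * r))"
      unfolding a_def b_def u2_def n2_def by (intro norm_powr_sum_le_ber nonneg r l k)
    then show "0 \<le> ber \<Omega>2 k2 (op_powr A (2 * r) + op_powr B (2 * r))"
      by (rule order_trans[rotated]) simp
    show "c powr (2 * r) + d powr (2 * r) \<le> ber \<Omega>1 k1 (op_powr C (2 * r) + op_powr D (2 * r))"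
      unfolding c_def d_def u1_def n1_def by (intro norm_powr_sum_le_ber nonneg r l k)
    \<comment> \<open>The preceding steps give the factor \<open>1 / 2\<close>; the stated constant
      is at least that since \<open>2 powr r \<ge> 1\<close>.\<close>
    show "1 / 2 \<le> 2 powr r / (2::real)" using r by (simp add: ge_one_powr_ge_zero)
  qed simp_all
  finally show "cmod (berezin_symbol (sum_kernel k1 k2) (block_op 0 X Y 0) l) powr r
    \<le> 2 powr r / 2 * ber \<Omega>2 k2 (op_powr A (2 * r) + op_powr B (2 * r)) powr (1/2)
      * ber \<Omega>1 k1 (op_powr C (2 * r) + op_powr D (2 * r)) powr (1/2)"
    unfolding s_def by (simp add: ber_nonneg[OF ne(1)] ber_nonneg[OF ne(2)] powr_half_sqrt real_sqrt_mult mult.assoc)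
qed (use ne r in auto)

theorem theorem2p4:
  fixes \<Omega>1 :: "'a set" and ev1 :: "'h1::complex_hilbert \<Rightarrow> 'a \<Rightarrow> complex"
    and \<Omega>2 :: "'b set" and ev2 :: "'h2::complex_hilbert \<Rightarrow> 'b \<Rightarrow> complex"
    and X :: "'h2 \<Rightarrow>\<^sub>L 'h1" and Y :: "'h1 \<Rightarrow>\<^sub>L 'h2"
    and T :: "('h1 \<times> 'h2) \<Rightarrow>\<^sub>L ('h1 \<times> 'h2)"
    and r :: real and f g :: "real \<Rightarrow> real"
  assumes H1: "functional_hilbert_space \<Omega>1 ev1"
    and H2: "functional_hilbert_space \<Omega>2 ev2"
    and X: "complex_linear X"
    and Y: "complex_linear Y"
    and T: "T = block_op 0 X Y 0"
    and r: "r \<ge> 1"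
    and f_cont: "continuous_on {0..} f" and f_nonneg: "\<forall>t\<ge>0. f t \<ge> 0"
    and g_cont: "continuous_on {0..} g" and g_nonneg: "\<forall>t\<ge>0. g t \<ge> 0"
    and fg: "\<forall>t\<ge>0. f t * g t = t"
  shows
   "(ber (\<Omega>1 \<times> \<Omega>2) (sum_kernel (rkernel ev1) (rkernel ev2)) T) powr r
      \<le> 2 powr r / 2
        * ber \<Omega>2 (rkernel ev2)
            (op_powr (cfc f (op_abs X)) (2 * r) + op_powr (cfc g (op_abs (adj Y))) (2 * r)) powr (1/2)
        * ber \<Omega>1 (rkernel ev1)
            (op_powr (cfc f (op_abs Y)) (2 * r) + op_powr (cfc g (op_abs (adj X))) (2 * r)) powr (1/2)
    \<and> (ber (\<Omega>1 \<times> \<Omega>2) (sum_kernel (rkernel ev1) (rkernel ev2)) T) powr r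
      \<le> 2 powr r / 2
        * ber \<Omega>2 (rkernel ev2)
            (op_powr (cfc f (op_abs X)) (2 * r) + op_powr (cfc f (op_abs (adj Y))) (2 * r)) powr (1/2)
        * ber \<Omega>1 (rkernel ev1)
            (op_powr (cfc g (op_abs Y)) (2 * r) + op_powr (cfc g (op_abs (adj X))) (2 * r)) powr (1/2)"
proof -
  interpret H1: functional_hilbert_space \<Omega>1 ev1 by (rule H1)
  interpret H2: functional_hilbert_space \<Omega>2 ev2 by (rule H2)
  \<comment> \<open>For \<open>Y\<close> the first inequality takes \<open>mixed_schwarz\<close>
    with the pair \<open>f\<close>, \<open>g\<close>, the second with \<open>g\<close>,
    \<open>f\<close>; \<open>mult.commute\<close> supplies the exchanged product identity.\<close>
  show ?thesis
    unfolding T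
    by (intro conjI ber_off_diagonal_le H1.nonempty H2.nonempty H1.rkernel_nonzero H2.rkernel_nonzero r
        cfc_nonneg op_nonneg_op_abs X Y complex_linear_adj mixed_schwarz f_cont g_cont)
      (use f_nonneg g_nonneg fg in \<open>auto simp: mult.commute\<close>)
qed

end
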